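(* Let $l_1,\ldots,l_m$ be positive integers and let $\alpha_1,\ldots,\alpha_m$ be distinct variables. Denote $\overline{\alpha}=(\alpha_1,\ldots,\alpha_m)^T$, $\overline{l}=(l_1,\ldots,l_m)^T$, $L:=l_1+\ldots+l_m$. Let $\mathcal{V}(\overline{\alpha})$ be the $L\times(L+1)$ matrix over $\mathbb{Z}[\alpha_1,\ldots,\alpha_m]$ whose rows are indexed by the pairs $(j,i)$ with $j=1,\ldots,m$, $i=1,\ldots,l_j$ (ordered lexicographically), whose columns are indexed by $h=0,1,\ldots,L$, and whose entry in row $(j,i)$ and column $h$ is $\binom{L+i}{h}\alpha_j^{L-h}$. For $h=0,\ldots,L$ let $\mathcal{V}[h]$ be the $L\times L$ minor of $\mathcal{V}(\overline{\alpha})$ obtained by removing the column with index $h$. Put $$ T(\overline{l},\overline{\alpha}):=\alpha_1^{\binom{l_1}{2}}\cdots\alpha_m^{\binom{l_m}{2}}\prod_{1\le i<j\le m}(\alpha_i-\alpha_j)^{\min\{l_i^2,\,l_j^2\}} . $$ Then there exist non-zero polynomials $B_{\overline{l},j}(t,\overline{\alpha})\in\mathbb{Q}[t,\overline{\alpha}]$, $j=0,1,\ldots,m$, and remainders $S_{\overline{l},j}(t,\overline{\alpha})$, $j=1,\ldots,m$, such that $$ B_{\overline{l},0}(t,\overline{\alpha})e^{\alpha_j t}-B_{\overline{l},j}(t,\overline{\alpha})=S_{\overline{l},j}(t,\overline{\alpha}),\quad j=1,\ldots,m, $$ where $$ \begin{cases}\deg_t B_{\overline{l},j}(t,\overline{\alpha})\le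 L, & j=0,\ldots,m;\\ L+l_j+1\le \operatorname{ord}_{t=0} S_{\overline{l},j}(t,\overline{\alpha})<\infty, & j=1,\ldots,m.\end{cases} $$ Moreover, $$ B_{\overline{l},0}(t,\overline{\alpha})=\sum_{i=0}^{L}\frac{L!}{i!}\,\tau_i(\overline{l},\overline{\alpha})\,t^i,\qquad \tau_i(\overline{l},\overline{\alpha})=\frac{(-1)^i\,\mathcal{V}[i]}{T(\overline{l},\overline{\alpha})}\in\mathbb{Z}[\overline{\alpha}], $$ where $T(\overline{l},\overline{\alpha})$ is a common factor of the $L\times L$ minors $\mathcal{V}[i]$, $i=0,\ldots,L$, of the matrix $\mathcal{V}(\overline{\alpha})$.
   Context: The exponential is the formal power series $e^{\alpha_j t}=\sum_{n\ge0}\alpha_j^n t^n/n!\in\mathbb{Q}[\overline{\alpha}][[t]]$, and the remainders are elements of $\mathbb{Q}[\overline{\alpha}][[t]]$. $\operatorname{ord}_{t=0}S$ is the smallest exponent of $t$ occurring with non-zero coefficient in $S$ ($\infty$ if $S=0$). $\deg_t$ is the degree in $t$. *)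

theory Defs
  imports
    "HOL-Library.Poly_Mapping"
    "HOL-Library.Extended_Nat"
    "HOL-Computational_Algebra.Polynomial_FPS"
    "Jordan_Normal_Form.Determinant"
    "Jordan_Normal_Form.DL_Submatrix"
begin

text \<open>
  Multivariate polynomials over a coefficient ring, in variables indexed by all natural numbers.
  The ring in the variables numbered \<open>1, \<dots>, m\<close> is the subset \<open>mpolys m\<close>.
\<close>

type_synonym 'a mpoly = "(nat \<Rightarrow>\<^sub>0 nat) \<Rightarrow>\<^sub>0 'a"

definition mvars :: "'a::zero mpoly \<Rightarrow> nat set" where
  "mvars p = (\<Union>mon \<in> Poly_Mapping.keys p. Poly_Mapping.keys mon)"

definition mpolys :: "nat \<Rightarrow> 'a::zero mpoly set" where
  "mpolys m = {p. mvars p \<subseteq> {1..m}}"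

definition alpha :: "nat \<Rightarrow> 'a::zero_neq_one mpoly" where
  "alpha j = Poly_Mapping.single (Poly_Mapping.single j 1) 1"

definition mconst :: "'a::zero \<Rightarrow> 'a mpoly" where
  "mconst c = Poly_Mapping.single 0 c"

definition rat_mpoly :: "int mpoly \<Rightarrow> rat mpoly" where
  "rat_mpoly p = Poly_Mapping.map of_int p"

text \<open>
  Polynomials in \<open>t\<close> and power series in \<open>t\<close> have type \<open>rat mpoly poly\<close> and \<open>rat mpoly fps\<close>.
  The library's \<open>fps_exp\<close> needs a field of coefficients, hence \<open>exp_t\<close>; the library's
  \<open>subdegree\<close> is \<open>0\<close> for the zero series, hence \<open>ord_t\<close>.
\<close>

definition exp_t :: "rat mpoly \<Rightarrow> rat mpoly fps" where
  "exp_t a = Abs_fps (\<lambda>n. mconst (1 / fact n) * a ^ n)"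

definition ord_t :: "'a::zero fps \<Rightarrow> enat" where
  "ord_t S = (if S = 0 then \<infinity> else enat (subdegree S))"

definition l_sum :: "nat \<Rightarrow> (nat \<Rightarrow> nat) \<Rightarrow> nat" where
  "l_sum m l = (\<Sum>j = 1..m. l j)"

definition row_index :: "nat \<Rightarrow> (nat \<Rightarrow> nat) \<Rightarrow> (nat \<times> nat) list" where
  "row_index m l = concat (map (\<lambda>j. map (\<lambda>i. (j, i)) [1..<l j + 1]) [1..<m + 1])"

definition V_mat :: "nat \<Rightarrow> (nat \<Rightarrow> nat) \<Rightarrow> int mpoly mat" where
  "V_mat m l = (let L = l_sum m l in
     mat L (L + 1) (\<lambda>(r, h). case row_index m l ! r of (j, i) \<Rightarrow>
       of_nat ((L + i) choose h) * alpha j ^ (L - h)))"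

definition V_minor :: "nat \<Rightarrow> (nat \<Rightarrow> nat) \<Rightarrow> nat \<Rightarrow> int mpoly" where
  "V_minor m l h = det (submatrix (V_mat m l) UNIV (- {h}))"

definition T_factor :: "nat \<Rightarrow> (nat \<Rightarrow> nat) \<Rightarrow> int mpoly" where
  "T_factor m l = (\<Prod>j = 1..m. alpha j ^ (l j choose 2)) *
     (\<Prod>j = 1..m. \<Prod>i = 1..<j. (alpha i - alpha j) ^ min ((l i)\<^sup>2) ((l j)\<^sup>2))"

end

theory Submission
  imports Defs
begin

text \<open>
  Multiplying the row \<open>(j, i)\<close> of \<open>V(\<alpha>)\<close> by \<open>\<alpha>\<^sub>j ^ i\<close> gives the coefficients of \<open>X ^ h\<close>, \<open>h \<le> L\<close>, in
  \<open>(X + \<alpha>\<^sub>j) ^ (L + i)\<close>. Adjoining the rows \<open>X ^ h\<close> and \<open>X ^ (L + k)\<close>, \<open>1 \<le> k \<le> L\<close>, turns \<open>V[h]\<close> into a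
  determinant all of whose rows are powers of linear polynomials, with the nodes \<open>\<alpha>\<^sub>1, \<dots>, \<alpha>\<^sub>m\<close> and the
  additional node \<open>0\<close>. Up to a unit it is invariant under \<open>X \<mapsto> X - b\<close>. Taking for \<open>b\<close> the node with the
  larger block of rows, every Leibniz term becomes divisible by the required power of the difference of
  two nodes, and these differences are pairwise non-associated prime elements.

  By Cramer's rule the quotients \<open>\<tau>\<^sub>h\<close> annihilate the coefficients of \<open>t ^ (L + 1), \<dots>, t ^ (L + l\<^sub>j)\<close> in
  \<open>B\<^sub>0 exp(\<alpha>\<^sub>j t)\<close>. They are not all zero, since \<open>V[L]\<close> has a monomial whose coefficient is a product of
  nonzero determinants of binomial coefficients, one for each block. If a remainder vanished, then
  \<open>\<Sum>\<^sub>h (n choose h) \<tau>\<^sub>h \<alpha>\<^sub>j ^ (L - h)\<close> would vanish for all \<open>n > L\<close>, which forces \<open>\<tau>\<^sub>h = 0\<close>.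
\<close>

section \<open>Substitution in multivariate polynomials\<close>

text \<open>Peels off one term at a time, so that claims about additive maps reduce to single
  monomials.\<close>

lemma poly_mapping_single_induct [case_names zero add]:
  fixes p :: "'a \<Rightarrow>\<^sub>0 'b::comm_monoid_add"
  assumes "P 0" and "\<And>k c q. P q \<Longrightarrow> P (Poly_Mapping.single k c + q)"
  shows "P p"
proof (induction p rule: update_induct)
  case const
  then show ?case using assms(1) by simp
next
  case (update q k c)
  have "Poly_Mapping.update k c q = Poly_Mapping.single k c + q"
    using update(1) by (intro poly_mapping_eqI)
      (auto simp: lookup_update lookup_add lookup_single in_keys_iff when_def)
  then show ?case using assms(2)[OF update(3)] by simp
qed

definition monom_eval :: "(nat \<Rightarrow> 'b::comm_ring_1) \<Rightarrow> (nat \<Rightarrow>\<^sub>0 nat) \<Rightarrow> 'b" where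
  "monom_eval g e = (\<Prod>v\<in>Poly_Mapping.keys e. g v ^ Poly_Mapping.lookup e v)"

definition msubst :: "(nat \<Rightarrow> 'b::comm_ring_1) \<Rightarrow> int mpoly \<Rightarrow> 'b" where
  "msubst g p = (\<Sum>e\<in>Poly_Mapping.keys p. of_int (Poly_Mapping.lookup p e) * monom_eval g e)"

lemma monom_eval_superset:
  assumes "finite A" "Poly_Mapping.keys e \<subseteq> A"
  shows "monom_eval g e = (\<Prod>v\<in>A. g v ^ Poly_Mapping.lookup e v)"
  unfolding monom_eval_def
  by (rule prod.mono_neutral_left) (use assms in \<open>auto simp: in_keys_iff\<close>)

lemma monom_eval_0 [simp]: "monom_eval g 0 = 1"
  by (simp add: monom_eval_def)

lemma monom_eval_single [simp]: "monom_eval g (Poly_Mapping.single v k) = g v ^ k"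
  by (subst monom_eval_superset[of "{v}"]) auto

lemma monom_eval_add: "monom_eval g (e + e') = monom_eval g e * monom_eval g e'"
proof -
  let ?A = "Poly_Mapping.keys e \<union> Poly_Mapping.keys e'"
  have "finite ?A" by simp
  moreover have "Poly_Mapping.keys (e + e') \<subseteq> ?A" by (rule keys_add)
  ultimately show ?thesis
    by (simp add: monom_eval_superset[of ?A] lookup_add power_add prod.distrib)
qed

lemma msubst_superset:
  assumes "finite A" "Poly_Mapping.keys p \<subseteq> A"
  shows "msubst g p = (\<Sum>e\<in>A. of_int (Poly_Mapping.lookup p e) * monom_eval g e)"
  unfolding msubst_def
  by (rule sum.mono_neutral_left) (use assms in \<open>auto simp: in_keys_iff\<close>)

lemma msubst_0 [simp]: "msubst g 0 = 0"
  by (simp add: msubst_def)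

lemma msubst_single [simp]: "msubst g (Poly_Mapping.single e c) = of_int c * monom_eval g e"
  by (subst msubst_superset[of "{e}"]) auto

lemma msubst_add: "msubst g (p + q) = msubst g p + msubst g q"
proof -
  let ?A = "Poly_Mapping.keys p \<union> Poly_Mapping.keys q"
  have "finite ?A" by simp
  moreover have "Poly_Mapping.keys (p + q) \<subseteq> ?A" by (rule keys_add)
  ultimately show ?thesis
    by (simp add: msubst_superset[of ?A] lookup_add distrib_right sum.distrib)
qed

lemma msubst_1 [simp]: "msubst g 1 = 1"
  by (simp flip: single_one)

lemma msubst_mult: "msubst g (p * q) = msubst g p * msubst g q"
proof (induction p rule: poly_mapping_single_induct)
  case (add e c p)
  have "msubst g (Poly_Mapping.single e c * q) = of_int c * monom_eval g e * msubst g q" for q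
    by (induction q rule: poly_mapping_single_induct)
      (simp_all add: distrib_left msubst_add mult_single monom_eval_add ac_simps)
  with add show ?case
    by (simp add: distrib_right msubst_add)
qed simp

lemma msubst_hom: "comm_ring_hom (msubst g)"
  by unfold_locales (simp_all add: msubst_add msubst_mult)

lemma msubst_alpha [simp]: "msubst g (alpha v) = g v"
  by (simp add: alpha_def)

lemma alpha_neq_0 [simp]: "alpha v \<noteq> (0 :: 'a::zero_neq_one mpoly)"
  unfolding alpha_def by (metis lookup_single_eq lookup_zero zero_neq_one)

lemma alpha_inject [simp]: "alpha v = (alpha w :: 'a::zero_neq_one mpoly) \<longleftrightarrow> v = w"
proof
  assume "alpha v = (alpha w :: 'a mpoly)"
  then have "Poly_Mapping.keys (alpha v :: 'a mpoly) = Poly_Mapping.keys (alpha w :: 'a mpoly)" by simp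
  then have "Poly_Mapping.single v (1::nat) = Poly_Mapping.single w 1" by (simp add: alpha_def)
  then have "Poly_Mapping.keys (Poly_Mapping.single v (1::nat)) = Poly_Mapping.keys (Poly_Mapping.single w (1::nat))"
    by simp
  then show "v = w" by simp
qed simp

lemma alpha_power: "alpha v ^ k = Poly_Mapping.single (Poly_Mapping.single v k) (1 :: 'a::comm_semiring_1)"
  by (induction k) (simp_all add: alpha_def mult_single flip: single_add)

lemma prod_single:
  fixes c :: "'i \<Rightarrow> 'a::comm_semiring_1"
  shows "(\<Prod>i\<in>A. Poly_Mapping.single (e i) (c i)) = Poly_Mapping.single (\<Sum>i\<in>A. e i) (\<Prod>i\<in>A. c i)"
  by (induction A rule: infinite_finite_induct) (simp_all add: mult_single)

lemma single_eq_monom_eval: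
  "Poly_Mapping.single e (c :: 'a::comm_ring_1) = mconst c * monom_eval alpha e"
proof -
  have "monom_eval alpha e
      = (\<Prod>v\<in>Poly_Mapping.keys e. Poly_Mapping.single (Poly_Mapping.single v (Poly_Mapping.lookup e v)) (1::'a))"
    by (simp add: monom_eval_def alpha_power)
  also have "\<dots> = Poly_Mapping.single (\<Sum>v\<in>Poly_Mapping.keys e. Poly_Mapping.single v (Poly_Mapping.lookup e v)) 1"
    by (simp add: prod_single)
  also have "(\<Sum>v\<in>Poly_Mapping.keys e. Poly_Mapping.single v (Poly_Mapping.lookup e v)) = e"
    by (rule poly_mapping_eqI)
       (auto simp: lookup_sum lookup_single when_def sum.delta' in_keys_iff)
  finally show ?thesis by (simp add: mconst_def mult_single)
qed

lemma mconst_of_int: "mconst (of_int c) = (of_int c :: 'a::comm_ring_1 mpoly)"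
  by (simp add: mconst_def)

lemma mconst_int: "mconst c = (of_int c :: int mpoly)"
  by (simp add: mconst_of_int[where 'a = int, simplified])

text \<open>Seen as an evaluation, the change of coefficients inherits all homomorphism
  laws.\<close>

lemma rat_mpoly_eq_msubst: "rat_mpoly p = msubst alpha p"
proof (induction p rule: poly_mapping_single_induct)
  case zero
  then show ?case by (simp add: rat_mpoly_def map_eq_zero_iff)
next
  case (add e c q)
  have "rat_mpoly (Poly_Mapping.single e c + q) = Poly_Mapping.single e (of_int c) + rat_mpoly q"
    by (rule poly_mapping_eqI)
      (simp add: rat_mpoly_def map.rep_eq lookup_add lookup_single when_def)
  also have "Poly_Mapping.single e (of_int c :: rat) = msubst alpha (Poly_Mapping.single e c)"
    by (simp only: msubst_single single_eq_monom_eval[of e "of_int c"] mconst_of_int)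
  finally show ?case by (simp only: add msubst_add)
qed

lemma rat_mpoly_hom: "inj_comm_ring_hom rat_mpoly"
proof -
  interpret comm_ring_hom rat_mpoly
    unfolding rat_mpoly_eq_msubst[abs_def] by (rule msubst_hom)
  show ?thesis
  proof
    fix p assume p: "rat_mpoly p = 0"
    show "p = 0"
    proof (rule poly_mapping_eqI)
      fix e
      have "Poly_Mapping.lookup (rat_mpoly p) e = 0" using p by simp
      then show "Poly_Mapping.lookup p e = Poly_Mapping.lookup 0 e"
        by (simp add: rat_mpoly_def map.rep_eq when_def split: if_splits)
    qed
  qed
qed

lemma rat_mpoly_alpha [simp]: "rat_mpoly (alpha v) = alpha v"
  by (simp add: rat_mpoly_eq_msubst)

section \<open>Closure properties of the ring in the variables 1, ..., m\<close>

lemma mpolys_iff: "p \<in> mpolys m \<longleftrightarrow> (\<forall>e\<in>Poly_Mapping.keys p. Poly_Mapping.keys e \<subseteq> {1..m})"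
  by (auto simp: mpolys_def mvars_def)

lemma mpolys_0 [simp]: "0 \<in> mpolys m"
  and mpolys_1 [simp]: "1 \<in> mpolys m"
  and mpolys_mconst [simp]: "mconst c \<in> mpolys m"
  and mpolys_alpha: "v \<in> {1..m} \<Longrightarrow> alpha v \<in> mpolys m"
  by (auto simp: mpolys_iff mconst_def alpha_def split: if_splits simp flip: single_one)

lemma mpolys_add:
  assumes "p \<in> mpolys m" "q \<in> mpolys m"
  shows "p + q \<in> mpolys m"
  using assms keys_add[of p q] unfolding mpolys_iff by blast

lemma mpolys_uminus: "p \<in> mpolys m \<Longrightarrow> - (p :: 'a::ab_group_add mpoly) \<in> mpolys m"
  by (auto simp: mpolys_iff in_keys_iff)

lemma mpolys_diff:
  "p \<in> mpolys m \<Longrightarrow> q \<in> mpolys m \<Longrightarrow> p - (q :: 'a::ab_group_add mpoly) \<in> mpolys m"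
  using mpolys_add[of p m "- q"] mpolys_uminus[of q m] by simp

lemma mpolys_mult:
  assumes "p \<in> mpolys m" "q \<in> mpolys m"
  shows "p * q \<in> mpolys m"
  unfolding mpolys_iff
proof
  fix e assume "e \<in> Poly_Mapping.keys (p * q)"
  then obtain a b where "e = a + b" "a \<in> Poly_Mapping.keys p" "b \<in> Poly_Mapping.keys q"
    using keys_mult[of p q] by blast
  with assms keys_add[of a b] show "Poly_Mapping.keys e \<subseteq> {1..m}"
    unfolding mpolys_iff by blast
qed

lemma mpolys_power: "p \<in> mpolys m \<Longrightarrow> (p :: 'a::comm_semiring_1 mpoly) ^ k \<in> mpolys m"
  by (induction k) (auto intro: mpolys_mult)

lemma mpolys_sum: "(\<And>i. i \<in> A \<Longrightarrow> f i \<in> mpolys m) \<Longrightarrow> sum f A \<in> mpolys m"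
  by (induction A rule: infinite_finite_induct) (auto intro: mpolys_add)

lemma mpolys_prod:
  "(\<And>i. i \<in> A \<Longrightarrow> (f i :: 'a::comm_semiring_1 mpoly) \<in> mpolys m) \<Longrightarrow> prod f A \<in> mpolys m"
  by (induction A rule: infinite_finite_induct) (auto intro: mpolys_mult)

lemma mpolys_msubst:
  fixes g :: "nat \<Rightarrow> 'a::comm_ring_1 mpoly"
  assumes "\<And>v. g v \<in> mpolys m"
  shows "msubst g p \<in> mpolys m"
proof -
  have "(of_int c :: 'a mpoly) \<in> mpolys m" for c :: int
    by (simp flip: mconst_of_int)
  then show ?thesis
    unfolding msubst_def monom_eval_def
    by (intro mpolys_sum mpolys_mult mpolys_prod mpolys_power assms)
qed

lemma mpolys_rat_mpoly: "p \<in> mpolys m \<Longrightarrow> rat_mpoly p \<in> mpolys m"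
proof -
  have "Poly_Mapping.keys (rat_mpoly p) \<subseteq> Poly_Mapping.keys p"
    by (auto simp: rat_mpoly_def in_keys_iff map.rep_eq when_def)
  then show "p \<in> mpolys m \<Longrightarrow> rat_mpoly p \<in> mpolys m"
    unfolding mpolys_iff by blast
qed

text \<open>Modulo \<open>d\<close> each variable is congruent to its image, and congruence is
  respected by powers, products and sums.\<close>

lemma dvd_msubst_diff:
  assumes "\<And>v. d dvd alpha v - g v"
  shows "d dvd p - msubst g p"
proof -
  have dvd_mult_diff: "d dvd x * y - x' * y'" if "d dvd x - x'" "d dvd y - y'" for x x' y y' :: "int mpoly"
  proof -
    have "x * y - x' * y' = (x - x') * y + x' * (y - y')" by (simp add: algebra_simps)
    with that show ?thesis by simp
  qed
  have power: "d dvd alpha v ^ k - g v ^ k" for v k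
    by (induction k) (auto intro: dvd_mult_diff assms)
  have "d dvd (\<Prod>v\<in>A. alpha v ^ h v) - (\<Prod>v\<in>A. g v ^ h v)" for A h
    by (induction A rule: infinite_finite_induct) (auto intro: dvd_mult_diff power)
  then have mon: "d dvd monom_eval alpha e - monom_eval g e" for e
    by (simp add: monom_eval_def)
  show ?thesis
  proof (induction p rule: poly_mapping_single_induct)
    case (add e c q)
    have "Poly_Mapping.single e c - msubst g (Poly_Mapping.single e c)
        = of_int c * (monom_eval alpha e - monom_eval g e)"
      by (subst single_eq_monom_eval, subst msubst_single) (simp only: mconst_int right_diff_distrib)
    moreover have "Poly_Mapping.single e c + q - msubst g (Poly_Mapping.single e c + q)
        = (Poly_Mapping.single e c - msubst g (Poly_Mapping.single e c)) + (q - msubst g q)"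
      by (simp only: msubst_add) (simp only: algebra_simps)
    ultimately have "Poly_Mapping.single e c + q - msubst g (Poly_Mapping.single e c + q)
        = of_int c * (monom_eval alpha e - monom_eval g e) + (q - msubst g q)"
      by (simp only:)
    with add mon show ?case by (simp only: dvd_add dvd_mult)
  qed simp
qed

text \<open>The substitution of \<open>c\<close> for variable \<open>v\<close> fixes
  \<open>c\<close>, so its kernel is generated by \<open>alpha v - c\<close>. The kernel of a
  homomorphism into an integral domain is a prime ideal.\<close>

lemma prime_elem_alpha_diff:
  fixes c :: "int mpoly"
  assumes "msubst (alpha(v := c)) c = c"
  shows "alpha v - c dvd p \<longleftrightarrow> msubst (alpha(v := c)) p = 0"
    and "alpha v \<noteq> c \<Longrightarrow> prime_elem (alpha v - c)"
proof -
  interpret comm_ring_hom "msubst (alpha(v := c))" by (rule msubst_hom)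
  have eq0: "msubst (alpha(v := c)) (alpha v - c) = 0"
    using assms by (simp add: hom_minus)
  show dvd_iff: "alpha v - c dvd p \<longleftrightarrow> msubst (alpha(v := c)) p = 0" for p
  proof
    assume "alpha v - c dvd p"
    then show "msubst (alpha(v := c)) p = 0"
      using eq0 by (auto simp: hom_mult elim!: dvdE)
  next
    assume "msubst (alpha(v := c)) p = 0"
    then show "alpha v - c dvd p"
      using dvd_msubst_diff[of "alpha v - c" "alpha(v := c)" p] by simp
  qed
  assume "alpha v \<noteq> c"
  then show "prime_elem (alpha v - c)"
    by (intro prime_elemI) (auto simp: dvd_iff hom_mult)
qed

section \<open>Divisibility by products of prime powers\<close>

lemma prime_elem_power_dvd_mult:
  fixes p :: "'a::idom"
  assumes "prime_elem p" "\<not> p dvd a" "p ^ k dvd a * b"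
  shows "p ^ k dvd b"
  using assms(3)
proof (induction k arbitrary: b)
  case (Suc k)
  have "p dvd p ^ Suc k" by simp
  with Suc.prems have "p dvd a * b" by (rule dvd_trans[rotated])
  with assms(1,2) have "p dvd b" using prime_elem_dvd_multD by blast
  then obtain c where c: "b = p * c" by (rule dvdE)
  have "p * p ^ k dvd p * (a * c)"
    using Suc.prems unfolding c power_Suc by (simp only: ac_simps)
  then have "p = 0 \<or> p ^ k dvd a * c"
    by (rule iffD1[OF dvd_mult_cancel_left])
  then have "p ^ k dvd a * c"
    using assms(1) by (auto simp only: not_prime_elem_zero)
  then have "p ^ k dvd c" by (rule Suc.IH)
  then show ?case
    unfolding c power_Suc by (rule mult_dvd_mono[OF dvd_refl])
qed simp

lemma prime_elem_dvd_prod: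
  assumes "prime_elem p" "p dvd prod f A"
  shows "\<exists>i\<in>A. p dvd f i"
  using assms(2)
proof (induction A rule: infinite_finite_induct)
  case (insert i A)
  then show ?case using assms(1) by (auto simp: prime_elem_dvd_mult_iff)
qed (use assms(1) in \<open>auto dest: prime_elem_not_unit\<close>)

text \<open>A further prime does not divide the product of the powers already split off, so its
  power must divide the remaining cofactor \<open>y\<close>.\<close>

lemma prod_prime_elem_power_dvd:
  fixes f :: "'i \<Rightarrow> 'a::idom"
  assumes "finite I" "\<And>i. i \<in> I \<Longrightarrow> prime_elem (f i)"
    and "\<And>i j. i \<in> I \<Longrightarrow> j \<in> I \<Longrightarrow> i \<noteq> j \<Longrightarrow> \<not> f i dvd f j"
    and "\<And>i. i \<in> I \<Longrightarrow> f i ^ k i dvd x"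
  shows "(\<Prod>i\<in>I. f i ^ k i) dvd x"
  using assms
proof (induction I rule: finite_induct)
  case (insert i I)
  then have "(\<Prod>j\<in>I. f j ^ k j) dvd x" by auto
  then obtain y where y: "x = (\<Prod>j\<in>I. f j ^ k j) * y" by (rule dvdE)
  have "prime_elem (f i)" using insert by simp
  have "\<not> f i dvd (\<Prod>j\<in>I. f j ^ k j)"
  proof
    assume "f i dvd (\<Prod>j\<in>I. f j ^ k j)"
    then obtain j where j: "j \<in> I" "f i dvd f j ^ k j"
      using prime_elem_dvd_prod[OF \<open>prime_elem (f i)\<close>] by blast
    with \<open>prime_elem (f i)\<close> have "f i dvd f j" using prime_elem_dvd_power by blast
    moreover have "i \<noteq> j" using insert.hyps(2) j(1) by blast
    ultimately show False using insert.prems(2)[of i j] j(1) by blast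
  qed
  moreover have "f i ^ k i dvd (\<Prod>j\<in>I. f j ^ k j) * y"
    using insert.prems(3)[of i] by (simp only: y insertI1)
  ultimately have "f i ^ k i dvd y"
    using \<open>prime_elem (f i)\<close> prime_elem_power_dvd_mult by blast
  then have "f i ^ k i * (\<Prod>j\<in>I. f j ^ k j) dvd y * (\<Prod>j\<in>I. f j ^ k j)"
    by (rule mult_dvd_mono) simp
  then show ?case
    by (simp only: prod.insert[OF insert.hyps] y mult.commute[of y])
qed simp

section \<open>Determinants of binomial powers\<close>

text \<open>Forward differences: by Pascal's rule, subtracting the relations at \<open>x\<close> and
  \<open>x + 1\<close> gives a relation of the same shape for the shifted sequence
  \<open>u (Suc k)\<close>, with one point and one term fewer. No division occurs, so any
  commutative ring will do.\<close>

lemma binomial_combination_eq_0: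
  fixes u :: "nat \<Rightarrow> 'a::comm_ring_1"
  assumes "\<And>x. N \<le> x \<Longrightarrow> x < N + l \<Longrightarrow> (\<Sum>k<l. of_nat (x choose k) * u k) = 0" and "k < l"
  shows "u k = 0"
  using assms
proof (induction l arbitrary: u k)
  case (Suc l)
  have pos: "u (Suc i) = 0" if "i < l" for i
  proof (rule Suc.IH[OF _ that])
    fix x assume x: "N \<le> x" "x < N + l"
    have "(\<Sum>k<l. of_nat (x choose k) * u (Suc k))
        = (\<Sum>k<Suc l. of_nat (Suc x choose k) * u k) - (\<Sum>k<Suc l. of_nat (x choose k) * u k)"
      by (simp add: sum.lessThan_Suc_shift sum.distrib algebra_simps del: sum.lessThan_Suc)
    also have "\<dots> = 0" using x by (simp add: Suc.prems(1) del: sum.lessThan_Suc)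
    finally show "(\<Sum>k<l. of_nat (x choose k) * u (Suc k)) = 0" .
  qed
  have "(\<Sum>k<Suc l. of_nat (N choose k) * u k) = u 0"
    using pos by (simp add: sum.lessThan_Suc_shift del: sum.lessThan_Suc)
  then have "u 0 = 0" using Suc.prems(1)[of N] by simp
  with pos Suc.prems(2) show ?case by (cases k) auto
qed simp

text \<open>The maximum of a set with \<open>n + 1\<close> elements is at least \<open>n\<close>;
  removing it leaves the same question for \<open>n\<close> elements. Equality forces the maximum to
  be \<open>n\<close> at every stage.\<close>

lemma sum_lessThan_card:
  fixes A :: "nat set"
  assumes "finite A"
  shows "\<Sum>{..<card A} \<le> \<Sum>A" and "\<Sum>A \<le> \<Sum>{..<card A} \<Longrightarrow> A = {..<card A}"
proof -
  have *: "\<Sum>{..<n} \<le> \<Sum>A \<and> (\<Sum>A \<le> \<Sum>{..<n} \<longrightarrow> A = {..<n})"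
    if "card A = n" "finite A" for n and A :: "nat set"
    using that
  proof (induction n arbitrary: A)
    case (Suc n)
    define M where "M = Max A"
    have "A \<noteq> {}" using Suc.prems by auto
    then have M: "M \<in> A" "A \<subseteq> {..M}" using Suc.prems by (auto simp: M_def)
    have "Suc n \<le> Suc M" using card_mono[of "{..M}" A] M Suc.prems by simp
    moreover have "\<Sum>A = M + \<Sum>(A - {M})" using M Suc.prems by (simp add: sum.remove)
    moreover have "card (A - {M}) = n" "finite (A - {M})" using M Suc.prems by simp_all
    note IH = Suc.IH[OF this]
    then have "\<Sum>{..<n} \<le> \<Sum>(A - {M})" by (rule conjunct1)
    moreover have "\<Sum>{..<Suc n} = \<Sum>{..<n} + n" by simp
    ultimately have le: "\<Sum>{..<Suc n} \<le> \<Sum>A"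
      and eq: "\<Sum>A \<le> \<Sum>{..<Suc n} \<Longrightarrow> M = n \<and> \<Sum>(A - {M}) \<le> \<Sum>{..<n}"
      by linarith+
    have IH2: "\<Sum>(A - {M}) \<le> \<Sum>{..<n} \<Longrightarrow> A - {M} = {..<n}" using IH by blast
    have "A = {..<Suc n}" if "\<Sum>A \<le> \<Sum>{..<Suc n}"
      using IH2 eq[OF that] M(1) lessThan_Suc[of n] by (metis insert_Diff)
    with le show ?case by blast
  qed simp
  from *[OF refl assms] show "\<Sum>{..<card A} \<le> \<Sum>A" "\<Sum>A \<le> \<Sum>{..<card A} \<Longrightarrow> A = {..<card A}"
    by auto
qed

text \<open>Column \<open>s\<close> belongs to the power \<open>X ^ c s\<close>, which lets the
  columns come in any order. Truncated subtraction is harmless: the binomial coefficient is 0 when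
  \<open>c s > n r\<close>.\<close>

definition binomial_mat :: "nat \<Rightarrow> (nat \<Rightarrow> nat) \<Rightarrow> (nat \<Rightarrow> nat) \<Rightarrow> (nat \<Rightarrow> 'a::comm_ring_1) \<Rightarrow> 'a mat" where
  "binomial_mat D c n y = mat D D (\<lambda>(r, s). of_nat (n r choose c s) * y r ^ (n r - c s))"

lemma binomial_mat_carrier [simp]: "binomial_mat D c n y \<in> carrier_mat D D"
  by (simp add: binomial_mat_def)

lemma binomial_mat_index [simp]:
  "r < D \<Longrightarrow> s < D \<Longrightarrow> binomial_mat D c n y $$ (r, s) = of_nat (n r choose c s) * y r ^ (n r - c s)"
  by (simp add: binomial_mat_def)

text \<open>Both sides are the coefficient of \<open>X ^ k\<close> in
  \<open>(X + b + x) ^ n\<close>, the left one computed by first expanding in powers of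
  \<open>X + b\<close>.\<close>

lemma binomial_translate:
  fixes x b :: "'a::comm_ring_1"
  assumes "n < D"
  shows "(\<Sum>h<D. of_nat (n choose h) * x ^ (n - h) * (of_nat (h choose k) * b ^ (h - k)))
       = of_nat (n choose k) * (x + b) ^ (n - k)"
proof (cases "k \<le> n")
  case True
  have "(\<Sum>h<D. of_nat (n choose h) * x ^ (n - h) * (of_nat (h choose k) * b ^ (h - k)))
      = (\<Sum>h\<in>{k..n}. of_nat (n choose h) * x ^ (n - h) * (of_nat (h choose k) * b ^ (h - k)))"
    using assms by (intro sum.mono_neutral_right) (auto simp: not_le binomial_eq_0)
  also have "\<dots> = (\<Sum>i\<in>{..n - k}. of_nat (n choose k) * (of_nat ((n - k) choose i) * b ^ i * x ^ (n - k - i)))"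
  proof (rule sum.reindex_bij_witness[of _ "\<lambda>i. i + k" "\<lambda>h. h - k"])
    fix h assume h: "h \<in> {k..n}"
    then have "(n choose h) * (h choose k) = (n choose k) * ((n - k) choose (h - k))"
      by (intro choose_mult) auto
    then have eq: "of_nat (n choose h) * of_nat (h choose k)
        = (of_nat (n choose k) * of_nat ((n - k) choose (h - k)) :: 'a)"
      by (metis of_nat_mult)
    have "n - k - (h - k) = n - h" using h by auto
    then have "of_nat (n choose k) * (of_nat ((n - k) choose (h - k)) * b ^ (h - k) * x ^ (n - k - (h - k)))
        = of_nat (n choose h) * of_nat (h choose k) * (x ^ (n - h) * b ^ (h - k))"
      unfolding eq by (simp only: ac_simps)
    also have "\<dots> = of_nat (n choose h) * x ^ (n - h) * (of_nat (h choose k) * b ^ (h - k))"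
      by (simp only: ac_simps)
    finally show "of_nat (n choose k) * (of_nat ((n - k) choose (h - k)) * b ^ (h - k) * x ^ (n - k - (h - k)))
        = of_nat (n choose h) * x ^ (n - h) * (of_nat (h choose k) * b ^ (h - k))" .
  qed (use True in auto)
  also have "\<dots> = of_nat (n choose k) * (x + b) ^ (n - k)"
    by (simp only: binomial_ring[of b x] sum_distrib_left add.commute[of x b])
  finally show ?thesis .
next
  case False
  \<comment> \<open>With \<open>n < k\<close>, either \<open>h > n\<close> or \<open>h < k\<close>,
    so one of the two binomial coefficients vanishes.\<close>
  then have "of_nat (n choose h) * x ^ (n - h) * (of_nat (h choose k) * b ^ (h - k)) = 0" for h
    by (cases "h \<le> n") (simp_all add: binomial_eq_0)
  with False show ?thesis by (simp add: binomial_eq_0)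
qed

text \<open>Row \<open>r\<close> lists the coefficients of \<open>(X + y r) ^ n r\<close>, so replacing \<open>X\<close> by \<open>X + b\<close> is a change of basis.\<close>
lemma binomial_mat_translate:
  assumes c: "bij_betw c {..<D} {..<D}" and n: "\<And>r. r < D \<Longrightarrow> n r < D"
  shows "binomial_mat D c n (\<lambda>r. y r + b) = binomial_mat D c n y * binomial_mat D c c (\<lambda>_. b)"
proof (rule eq_matI)
  fix r s assume "r < dim_row (binomial_mat D c n y * binomial_mat D c c (\<lambda>_. b))"
    and "s < dim_col (binomial_mat D c n y * binomial_mat D c c (\<lambda>_. b))"
  then have rs: "r < D" "s < D" by (auto simp: binomial_mat_def)
  have "(binomial_mat D c n y * binomial_mat D c c (\<lambda>_. b)) $$ (r, s)
      = (\<Sum>i<D. of_nat (n r choose c i) * y r ^ (n r - c i) * (of_nat (c i choose c s) * b ^ (c i - c s)))"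
    using rs by (simp add: binomial_mat_def scalar_prod_def lessThan_atLeast0)
  also have "\<dots> = (\<Sum>h<D. of_nat (n r choose h) * y r ^ (n r - h) * (of_nat (h choose c s) * b ^ (h - c s)))"
    by (rule sum.reindex_bij_betw[OF c])
  also have "\<dots> = of_nat (n r choose c s) * (y r + b) ^ (n r - c s)"
    by (rule binomial_translate[OF n[OF rs(1)]])
  finally show "binomial_mat D c n (\<lambda>r. y r + b) $$ (r, s)
      = (binomial_mat D c n y * binomial_mat D c c (\<lambda>_. b)) $$ (r, s)"
    using rs by simp
qed (simp_all add: binomial_mat_def)

text \<open>The determinant of the change of basis is the cofactor. A factor found after moving one
  node to 0 thus passes to the original determinant.\<close>

lemma det_binomial_mat_translate_dvd:
  assumes "bij_betw c {..<D} {..<D}" and "\<And>r. r < D \<Longrightarrow> n r < D"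
  shows "det (binomial_mat D c n (\<lambda>r. y r - b)) dvd det (binomial_mat D c n y)"
proof -
  have "binomial_mat D c n y = binomial_mat D c n (\<lambda>r. y r - b) * binomial_mat D c c (\<lambda>_. b)"
    using binomial_mat_translate[OF assms, where y = "\<lambda>r. y r - b" and b = b] by simp
  then have "det (binomial_mat D c n y) = det (binomial_mat D c n (\<lambda>r. y r - b)) * det (binomial_mat D c c (\<lambda>_. b))"
    by (metis binomial_mat_carrier det_mult)
  then show ?thesis by (rule dvdI)
qed

text \<open>In each nonzero Leibniz term the rows \<open>\<sigma> k\<close> occupy the columns \<open>N + k\<close>, which forces the
  rows \<open>\<rho> k\<close> into distinct columns \<open>\<le> N\<close>; the exponents of \<open>e\<close> then add up to at least
  \<open>(1 + \<dots> + p) + (0 + \<dots> + (p - 1)) = p\<^sup>2\<close>.\<close>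
lemma power_dvd_det_binomial_mat:
  fixes y :: "nat \<Rightarrow> 'a::comm_ring_1"
  assumes c: "inj_on c {..<D}" and "p \<le> q"
    and \<rho>: "\<And>k. k \<in> {1..p} \<Longrightarrow> \<rho> k < D \<and> n (\<rho> k) = N + k \<and> y (\<rho> k) = e" "inj_on \<rho> {1..p}"
    and \<sigma>: "\<And>k. k \<in> {1..q} \<Longrightarrow> \<sigma> k < D \<and> n (\<sigma> k) = N + k \<and> y (\<sigma> k) = 0"
    and disj: "\<And>k k'. k \<in> {1..p} \<Longrightarrow> k' \<in> {1..q} \<Longrightarrow> \<rho> k \<noteq> \<sigma> k'"
  shows "e ^ p\<^sup>2 dvd det (binomial_mat D c n y)"
  unfolding det_def'[OF binomial_mat_carrier]
proof (rule dvd_sum)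
  fix \<pi> assume "\<pi> \<in> {\<pi>. \<pi> permutes {0..<D}}"
  then have \<pi>: "\<pi> permutes {0..<D}" by simp
  then have \<pi>_lt: "\<pi> r < D" if "r < D" for r
    using that permutes_in_image[OF \<pi>, of r] by simp
  define t where "t r = of_nat (n r choose c (\<pi> r)) * y r ^ (n r - c (\<pi> r))" for r
  have prod_t: "(\<Prod>r = 0..<D. binomial_mat D c n y $$ (r, \<pi> r)) = (\<Prod>r = 0..<D. t r)"
    by (rule prod.cong) (auto simp: t_def \<pi>_lt)
  have "e ^ p\<^sup>2 dvd (\<Prod>r = 0..<D. t r)"
  proof (cases "\<exists>r<D. t r = 0")
    case True
    then have "(\<Prod>r = 0..<D. t r) = 0" by (metis atLeastLessThan_iff finite_atLeastLessThan le0 prod_zero)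
    then show ?thesis by simp
  next
    case False
    then have nz: "t r \<noteq> 0" if "r < D" for r using that by blast
    have le: "c (\<pi> r) \<le> n r" if "r < D" for r
      using nz[OF that] by (cases "c (\<pi> r) \<le> n r") (auto simp: t_def binomial_eq_0)
    \<comment> \<open>A smaller column index would leave a positive power of the node 0 in this
      row.\<close>
    have c\<sigma>: "c (\<pi> (\<sigma> k)) = N + k" if "k \<in> {1..q}" for k
    proof (rule ccontr)
      assume "c (\<pi> (\<sigma> k)) \<noteq> N + k"
      moreover have "c (\<pi> (\<sigma> k)) \<le> N + k" using le[of "\<sigma> k"] \<sigma>[OF that] by simp
      ultimately have "0 < N + k - c (\<pi> (\<sigma> k))" by simp
      then have "t (\<sigma> k) = 0" using \<sigma>[OF that] by (simp add: t_def zero_power)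
      with nz[of "\<sigma> k"] \<sigma>[OF that] show False by simp
    qed
    have inj_c\<pi>: "r = r'" if "c (\<pi> r) = c (\<pi> r')" "r < D" "r' < D" for r r'
      using inj_onD[OF c that(1)] that \<pi>_lt permutes_inj[OF \<pi>] by (auto dest: injD)
    have c\<rho>: "c (\<pi> (\<rho> k)) \<le> N" if k: "k \<in> {1..p}" for k
    proof (rule ccontr)
      assume gt: "\<not> c (\<pi> (\<rho> k)) \<le> N"
      \<comment> \<open>A column index above \<open>N\<close> is \<open>N + k'\<close> with
        \<open>k' \<le> k \<le> p \<le> q\<close>, and that column is already taken by row
        \<open>\<sigma> k'\<close>.\<close>
      define k' where "k' = c (\<pi> (\<rho> k)) - N"
      have "c (\<pi> (\<rho> k)) \<le> N + k" using le[of "\<rho> k"] \<rho>(1)[OF k] by simp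
      with gt k \<open>p \<le> q\<close> have k': "k' \<in> {1..q}" "c (\<pi> (\<rho> k)) = N + k'" by (auto simp: k'_def)
      then have "\<rho> k = \<sigma> k'"
        using inj_c\<pi>[of "\<rho> k" "\<sigma> k'"] c\<sigma> \<sigma> \<rho>(1)[OF k] by simp
      with disj k k'(1) show False by blast
    qed
    define w where "w k = N - c (\<pi> (\<rho> k))" for k
    have "inj_on w {1..p}"
    proof (rule inj_onI)
      fix k k' assume k: "k \<in> {1..p}" "k' \<in> {1..p}" "w k = w k'"
      then have "c (\<pi> (\<rho> k)) = c (\<pi> (\<rho> k'))" using c\<rho>[of k] c\<rho>[of k'] by (simp add: w_def)
      then have "\<rho> k = \<rho> k'" using inj_c\<pi> \<rho>(1) k by blast
      then show "k = k'" using \<rho>(2) k by (meson inj_onD)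
    qed
    then have "\<Sum>{..<p} \<le> (\<Sum>k\<in>{1..p}. w k)"
      using sum_lessThan_card(1)[of "w ` {1..p}"] by (simp add: card_image sum.reindex)
    moreover have "p\<^sup>2 = \<Sum>{1..p} + \<Sum>{..<p}"
      by (induction p) (auto simp: power2_eq_square)
    ultimately have exp_le: "p\<^sup>2 \<le> (\<Sum>k\<in>{1..p}. k + w k)" by (simp add: sum.distrib)
    have "e ^ (k + w k) dvd t (\<rho> k)" if "k \<in> {1..p}" for k
      using \<rho>(1)[OF that] c\<rho>[OF that] by (simp add: t_def w_def add.commute)
    then have "(\<Prod>k\<in>{1..p}. e ^ (k + w k)) dvd (\<Prod>k\<in>{1..p}. t (\<rho> k))"
      by (rule prod_dvd_prod)
    also have "(\<Prod>k\<in>{1..p}. t (\<rho> k)) = (\<Prod>r\<in>\<rho> ` {1..p}. t r)"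
      using \<rho>(2) by (simp add: prod.reindex)
    also have "\<dots> dvd (\<Prod>r = 0..<D. t r)"
      using \<rho>(1) by (intro prod_dvd_prod_subset) auto
    finally have "e ^ (\<Sum>k\<in>{1..p}. k + w k) dvd (\<Prod>r = 0..<D. t r)"
      by (simp only: power_sum)
    with le_imp_power_dvd[OF exp_le] show ?thesis by (rule dvd_trans)
  qed
  then show "e ^ p\<^sup>2 dvd signof \<pi> * (\<Prod>r = 0..<D. binomial_mat D c n y $$ (r, \<pi> r))"
    unfolding prod_t by (rule dvd_mult)
qed

section \<open>The common factor of the minors\<close>

lemma l_sum_Suc: "l_sum (Suc m) l = l_sum m l + l (Suc m)"
  by (simp add: l_sum_def)

lemma l_sum_mono: "m \<le> m' \<Longrightarrow> l_sum m l \<le> l_sum m' l"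
  unfolding l_sum_def by (rule sum_mono2) auto

lemma le_l_sum: "j \<in> {1..m} \<Longrightarrow> l j \<le> l_sum m l"
  unfolding l_sum_def by (rule member_le_sum) auto

lemma l_sum_add_less:
  assumes "j \<in> {1..m}" "k < l j"
  shows "l_sum (j - 1) l + k < l_sum m l"
proof -
  have "l_sum (j - 1) l + l j = l_sum j l"
    using assms(1) l_sum_Suc[of "j - 1" l] by simp
  with assms l_sum_mono[of j m l] show ?thesis by simp
qed

lemma row_index_Suc:
  "row_index (Suc m) l = row_index m l @ map (Pair (Suc m)) [1..<l (Suc m) + 1]"
  by (simp add: row_index_def)

lemma length_row_index: "length (row_index m l) = l_sum m l"
proof (induction m)
  case 0
  then show ?case by (simp add: row_index_def l_sum_def)
next
  case (Suc m)
  then show ?case by (simp only: row_index_Suc l_sum_Suc length_append length_map length_upt add_diff_cancel_right')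
qed

lemma row_index_nth:
  assumes "j \<in> {1..m}" "k < l j"
  shows "row_index m l ! (l_sum (j - 1) l + k) = (j, Suc k)"
  using assms
proof (induction m)
  case (Suc m)
  show ?case
  proof (cases "j = Suc m")
    case True
    with Suc.prems show ?thesis
      unfolding row_index_Suc by (simp add: nth_append length_row_index del: upt_Suc)
  next
    case False
    with Suc.prems have j: "j \<in> {1..m}" by auto
    with Suc show ?thesis
      unfolding row_index_Suc using l_sum_add_less[where l = l, OF j Suc.prems(2)]
      by (simp add: nth_append length_row_index del: upt_Suc)
  qed
qed simp

lemma row_index_cases:
  assumes "r < l_sum m l"
  obtains j k where "j \<in> {1..m}" "k < l j" "r = l_sum (j - 1) l + k"
proof -
  have "\<exists>j\<in>{1..m}. \<exists>k<l j. r = l_sum (j - 1) l + k"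
    using assms
  proof (induction m)
    case 0
    then show ?case by (simp add: l_sum_def)
  next
    case (Suc m)
    show ?case
    proof (cases "r < l_sum m l")
      case True
      with Suc.IH show ?thesis by (metis atLeastAtMost_iff le_SucI)
    next
      case False
      with Suc.prems show ?thesis
        by (intro bexI[of _ "Suc m"] exI[of _ "r - l_sum m l"]) (auto simp: l_sum_Suc)
    qed
  qed
  with that show thesis by blast
qed

lemma prod_row_index:
  fixes f :: "nat \<times> nat \<Rightarrow> 'a::comm_monoid_mult"
  shows "(\<Prod>r<l_sum m l. f (row_index m l ! r)) = (\<Prod>j=1..m. \<Prod>i=1..l j. f (j, i))"
proof -
  have "prod_list (map f (row_index m l)) = (\<Prod>j=1..m. \<Prod>i=1..l j. f (j, i))"
  proof (induction m)
    case 0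
    then show ?case by (simp add: row_index_def)
  next
    case (Suc m)
    have "prod_list (map f (map (Pair (Suc m)) [1..<l (Suc m) + 1])) = (\<Prod>i=1..l (Suc m). f (Suc m, i))"
      by (subst map_map, subst prod.distinct_set_conv_list[symmetric])
        (simp_all add: o_def atLeastLessThanSuc_atLeastAtMost del: upt_Suc)
    with Suc show ?case
      by (simp only: row_index_Suc map_append prod_list.append) simp
  qed
  then show ?thesis
    by (simp add: prod.list_conv_set_nth length_row_index lessThan_atLeast0)
qed

section \<open>The minors as determinants with explicit column indices\<close>

definition skip :: "nat \<Rightarrow> nat \<Rightarrow> nat" where
  "skip h s = (if s < h then s else Suc s)"

lemma pick_Compl_singleton: "pick (- {h}) s = skip h s"
proof -
  have "{a \<in> - {h}. a < skip h s} = (if s < h then {..<s} else {..<Suc s} - {h})"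
    by (auto simp: skip_def)
  \<comment> \<open>An element of a set is its \<open>s\<close>-th one, counted from 0, when exactly
    \<open>s\<close> elements lie below it.\<close>
  then have "card {a \<in> - {h}. a < skip h s} = s" by (auto simp: not_less)
  moreover have "skip h s \<in> - {h}" by (simp add: skip_def)
  ultimately show ?thesis using pick_card_in_set[of "skip h s" "- {h}"] by simp
qed

lemma V_minor_eq:
  assumes "h \<le> l_sum m l"
  shows "V_minor m l h = det (mat (l_sum m l) (l_sum m l) (\<lambda>(r, s). V_mat m l $$ (r, skip h s)))"
proof -
  have "{j. j < Suc (l_sum m l) \<and> j \<noteq> h} = {..<Suc (l_sum m l)} - {h}" by auto
  then have "card {j. j < Suc (l_sum m l) \<and> j \<noteq> h} = l_sum m l" using assms by simp
  then have "submatrix (V_mat m l) UNIV (- {h})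
      = mat (l_sum m l) (l_sum m l) (\<lambda>(r, s). V_mat m l $$ (r, skip h s))"
    by (simp add: submatrix_def pick_UNIV pick_Compl_singleton V_mat_def Let_def)
  then show ?thesis by (simp add: V_minor_def)
qed

lemma V_mat_index:
  assumes "r < l_sum m l" "h \<le> l_sum m l" "row_index m l ! r = (j, i)"
  shows "V_mat m l $$ (r, h) = of_nat ((l_sum m l + i) choose h) * alpha j ^ (l_sum m l - h)"
  using assms by (simp add: V_mat_def Let_def)

lemma det_scale_rows:
  "det (mat n n (\<lambda>(r, s). f r * A r s)) = (\<Prod>r<n. f r) * det (mat n n (\<lambda>(r, s). A r s))"
proof -
  have "(\<Prod>i=0..<n. mat n n (\<lambda>(r, s). f r * A r s) $$ (i, \<pi> i))
      = (\<Prod>r<n. f r) * (\<Prod>i=0..<n. mat n n (\<lambda>(r, s). A r s) $$ (i, \<pi> i))"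
    if "\<pi> permutes {0..<n}" for \<pi>
  proof -
    have "\<pi> r < n" if "r < n" for r
      using that permutes_in_image[OF \<open>\<pi> permutes {0..<n}\<close>, of r] by simp
    then show ?thesis
      unfolding lessThan_atLeast0 prod.distrib[symmetric] by (intro prod.cong) auto
  qed
  then have "det (mat n n (\<lambda>(r, s). f r * A r s)) = (\<Sum>\<pi> | \<pi> permutes {0..<n}.
      signof \<pi> * ((\<Prod>r<n. f r) * (\<Prod>i=0..<n. mat n n (\<lambda>(r, s). A r s) $$ (i, \<pi> i))))"
    by (subst det_def'[OF mat_carrier]) (intro sum.cong, auto)
  also have "\<dots> = (\<Prod>r<n. f r) * det (mat n n (\<lambda>(r, s). A r s))"
    by (subst det_def'[OF mat_carrier]) (simp only: sum_distrib_left mult.left_commute)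
  finally show ?thesis .
qed

text \<open>The omitted column \<open>h\<close> is moved to position \<open>L\<close>, and row \<open>L\<close> is \<open>X ^ h\<close>. The rows \<open>X ^ (L + k)\<close>,
  \<open>1 \<le> k \<le> L\<close>, have row number \<open>L + k\<close> and form the block \<open>m + 1\<close>, with node \<open>0\<close>.\<close>

definition ext_col :: "nat \<Rightarrow> nat \<Rightarrow> nat \<Rightarrow> nat" where
  "ext_col L h s = (if s < L then skip h s else if s = L then h else s)"

definition ext_exp :: "nat \<Rightarrow> (nat \<Rightarrow> nat) \<Rightarrow> nat \<Rightarrow> nat \<Rightarrow> nat" where
  "ext_exp m l h r = (let L = l_sum m l in
     if r < L then L + snd (row_index m l ! r) else if r = L then h else r)"

text \<open>With node 0 at index \<open>m + 1\<close>, each \<open>alpha j\<close> is itself a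
  difference of two nodes, so the powers of single variables and of differences are treated
  alike.\<close>

definition node :: "nat \<Rightarrow> nat \<Rightarrow> int mpoly" where
  "node m j = (if j \<le> m then alpha j else 0)"

definition ext_node :: "nat \<Rightarrow> (nat \<Rightarrow> nat) \<Rightarrow> nat \<Rightarrow> int mpoly" where
  "ext_node m l r = (if r < l_sum m l then alpha (fst (row_index m l ! r)) else 0)"

definition ext_mat :: "nat \<Rightarrow> (nat \<Rightarrow> nat) \<Rightarrow> nat \<Rightarrow> int mpoly mat" where
  "ext_mat m l h = binomial_mat (2 * l_sum m l + 1) (ext_col (l_sum m l) h) (ext_exp m l h) (ext_node m l)"

lemma bij_betw_ext_col:
  assumes "h \<le> L"
  shows "bij_betw (ext_col L h) {..<2 * L + 1} {..<2 * L + 1}"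
proof -
  have "inj_on (ext_col L h) {..<2 * L + 1}"
    using assms by (intro inj_onI) (auto simp: ext_col_def skip_def split: if_splits)
  moreover have "ext_col L h ` {..<2 * L + 1} \<subseteq> {..<2 * L + 1}"
    using assms by (auto simp: ext_col_def skip_def)
  ultimately show ?thesis
    by (simp add: bij_betw_def endo_inj_surj)
qed

lemma ext_exp_less:
  assumes "h \<le> l_sum m l" "r < 2 * l_sum m l + 1"
  shows "ext_exp m l h r < 2 * l_sum m l + 1"
proof (cases "r < l_sum m l")
  case True
  then obtain j k where "j \<in> {1..m}" "k < l j" "r = l_sum (j - 1) l + k" by (rule row_index_cases)
  with True le_l_sum[of j m l] row_index_nth[of j m k l] show ?thesis
    by (simp add: ext_exp_def Let_def)
qed (use assms in \<open>auto simp: ext_exp_def Let_def\<close>)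

text \<open>The adjoined rows become unit vectors in the chosen column order, so the matrix is block
  triangular. Its upper left block is the minor with row \<open>(j, i)\<close> multiplied by
  \<open>alpha j ^ i\<close>, and \<open>1 + ... + l j = Suc (l j) choose 2\<close>.\<close>

lemma det_ext_mat:
  assumes h: "h \<le> l_sum m l"
  shows "det (ext_mat m l h) = (\<Prod>j=1..m. alpha j ^ (Suc (l j) choose 2)) * V_minor m l h"
proof -
  define L where "L = l_sum m l"
  define f :: "nat \<Rightarrow> int mpoly" where "f r = alpha (fst (row_index m l ! r)) ^ snd (row_index m l ! r)" for r
  define A where "A = mat L L (\<lambda>(r, s). f r * V_mat m l $$ (r, skip h s))"
  define B where "B = mat L (Suc L) (\<lambda>(r, s). ext_mat m l h $$ (r, s + L))"
  have entry: "ext_mat m l h $$ (r, s) = of_nat (ext_exp m l h r choose ext_col L h s) *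
      ext_node m l r ^ (ext_exp m l h r - ext_col L h s)" if "r < 2 * L + 1" "s < 2 * L + 1" for r s
    using that by (simp add: ext_mat_def L_def)
  have skip_le: "skip h s \<le> L" if "s < L" for s using that by (auto simp: skip_def)
  have "ext_mat m l h = four_block_mat A B (0\<^sub>m (Suc L) L) (1\<^sub>m (Suc L))"
  proof (rule eq_matI)
    fix r s
    assume "r < dim_row (four_block_mat A B (0\<^sub>m (Suc L) L) (1\<^sub>m (Suc L)))"
      and "s < dim_col (four_block_mat A B (0\<^sub>m (Suc L) L) (1\<^sub>m (Suc L)))"
    then have rs: "r < 2 * L + 1" "s < 2 * L + 1" by (auto simp: A_def)
    consider "r < L" "s < L" | "r < L" "s \<ge> L" | "r \<ge> L" by linarith
    then show "ext_mat m l h $$ (r, s) = four_block_mat A B (0\<^sub>m (Suc L) L) (1\<^sub>m (Suc L)) $$ (r, s)"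
    proof cases
      case 1
      obtain j i where ji: "row_index m l ! r = (j, i)" by fastforce
      have "L + i - skip h s = i + (L - skip h s)" using skip_le[OF 1(2)] by simp
      then have "alpha j ^ (L + i - skip h s) = alpha j ^ i * (alpha j ^ (L - skip h s) :: int mpoly)"
        by (simp only: power_add)
      then have "ext_mat m l h $$ (r, s) = f r * V_mat m l $$ (r, skip h s)"
        using 1 ji skip_le[OF 1(2)]
        by (simp add: entry[OF rs] V_mat_index[of r m l "skip h s" j i] f_def ext_exp_def ext_node_def
            ext_col_def L_def[symmetric] ac_simps)
      with 1 show ?thesis by (simp add: A_def)
    next
      case 2
      with rs show ?thesis by (simp add: A_def B_def)
    next
      case 3
      \<comment> \<open>Both functions list \<open>h, L + 1, L + 2, ...\<close> from position
        \<open>L\<close> on. With node 0 the row then has its only nonzero entry,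
        \<open>0 ^ 0 = 1\<close>, on the diagonal.\<close>
      have exp: "ext_exp m l h r = ext_col L h r"
        using 3 by (auto simp: ext_exp_def ext_col_def Let_def L_def)
      have "ext_col L h r = ext_col L h s \<longleftrightarrow> r = s"
        using bij_betw_ext_col[of h L] h rs by (auto simp: L_def bij_betw_def inj_on_eq_iff)
      then have "ext_mat m l h $$ (r, s) = (if r = s then 1 else 0)"
        using 3 rs by (auto simp: entry exp ext_node_def L_def[symmetric] zero_power binomial_eq_0 neq_iff)
      with 3 rs show ?thesis by (auto simp: A_def B_def)
    qed
  qed (simp_all add: ext_mat_def binomial_mat_def L_def A_def)
  then have "det (ext_mat m l h) = det A * det (1\<^sub>m (Suc L))"
    by (simp only:) (rule det_four_block_mat_lower_left_zero, auto simp: A_def B_def)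
  also have "det A = (\<Prod>r<L. f r) * V_minor m l h"
    unfolding A_def det_scale_rows using V_minor_eq[OF h] by (simp add: L_def)
  also have "(\<Prod>r<L. f r) = (\<Prod>j=1..m. alpha j ^ (Suc (l j) choose 2))"
  proof -
    have "(\<Prod>r<L. f r) = (\<Prod>j=1..m. \<Prod>i=1..l j. alpha j ^ i)"
      using prod_row_index[where f = "\<lambda>(j, i). alpha j ^ i :: int mpoly" and l = l and m = m]
      by (simp add: L_def f_def case_prod_unfold)
    moreover have "(\<Prod>i=1..n. alpha j ^ i) = (alpha j ^ (Suc n choose 2) :: int mpoly)" for j n
      by (induction n) (simp_all add: numeral_2_eq_2 power_add ac_simps)
    ultimately show ?thesis by simp
  qed
  finally show ?thesis by simp
qed

text \<open>The block of node 0 has \<open>L\<close> rows and is therefore at least as large as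
  every other block.\<close>

definition block_size :: "nat \<Rightarrow> (nat \<Rightarrow> nat) \<Rightarrow> nat \<Rightarrow> nat" where
  "block_size m l j = (if j \<le> m then l j else l_sum m l)"

text \<open>Locates the row with exponent \<open>L + k\<close> in block \<open>j\<close>. The offset
  is \<open>k\<close> instead of \<open>k - 1\<close> in the last block because row \<open>L\<close>
  is \<open>X ^ h\<close>. The last two claims recover \<open>j\<close> and \<open>k\<close> from
  the position, so blocks are disjoint.\<close>

lemma ext_block:
  assumes "j \<in> {1..Suc m}" "k \<in> {1..block_size m l j}"
  defines "r \<equiv> l_sum (j - 1) l + (if j \<le> m then k - 1 else k)"
  shows "r < 2 * l_sum m l + 1" and "ext_exp m l h r = l_sum m l + k" and "ext_node m l r = node m j"
    and "r < l_sum m l \<Longrightarrow> row_index m l ! r = (j, k)" and "l_sum m l \<le> r \<Longrightarrow> j = Suc m \<and> r = l_sum m l + k"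
proof -
  consider "j \<in> {1..m}" "k - 1 < l j" "k > 0" | "j = Suc m"
    using assms(1,2) by (fastforce simp: block_size_def)
  then have "r < 2 * l_sum m l + 1 \<and> ext_exp m l h r = l_sum m l + k \<and> ext_node m l r = node m j \<and>
      (r < l_sum m l \<longrightarrow> row_index m l ! r = (j, k)) \<and> (l_sum m l \<le> r \<longrightarrow> j = Suc m \<and> r = l_sum m l + k)"
  proof cases
    case 1
    have "r = l_sum (j - 1) l + (k - 1)" using 1 by (simp add: r_def)
    with row_index_nth[where l = l, OF 1(1,2)] l_sum_add_less[where l = l, OF 1(1,2)] 1
    have "row_index m l ! r = (j, k)" "r < l_sum m l" by auto
    with 1 show ?thesis by (simp add: ext_exp_def ext_node_def node_def Let_def)
  next
    case 2
    with assms(2) show ?thesis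
      by (auto simp: r_def ext_exp_def ext_node_def node_def block_size_def Let_def)
  qed
  then show "r < 2 * l_sum m l + 1" "ext_exp m l h r = l_sum m l + k" "ext_node m l r = node m j"
    "r < l_sum m l \<Longrightarrow> row_index m l ! r = (j, k)" "l_sum m l \<le> r \<Longrightarrow> j = Suc m \<and> r = l_sum m l + k"
    by auto
qed

text \<open>Subtracting node \<open>b\<close> from all nodes turns the larger block into the one
  with node 0 and gives the smaller block the node difference as its node.\<close>

lemma node_diff_power_dvd_det_ext_mat:
  assumes h: "h \<le> l_sum m l" and ab: "a \<in> {1..Suc m}" "b \<in> {1..Suc m}" "a \<noteq> b"
    and le: "block_size m l a \<le> block_size m l b"
  shows "(node m a - node m b) ^ (block_size m l a)\<^sup>2 dvd det (ext_mat m l h)"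
proof -
  let ?L = "l_sum m l" and ?D = "2 * l_sum m l + 1"
  let ?r = "\<lambda>j k. l_sum (j - 1) l + (if j \<le> m then k - 1 else k)"
  have r_inj: "j = j' \<and> k = k'" if "?r j k = ?r j' k'" "j \<in> {1..Suc m}" "k \<in> {1..block_size m l j}"
    "j' \<in> {1..Suc m}" "k' \<in> {1..block_size m l j'}" for j k j' k'
    using ext_block(4,5)[OF that(2,3)] ext_block(4,5)[OF that(4,5)] that(1)
    by (cases "?r j k < ?L") auto
  have "(node m a - node m b) ^ (block_size m l a)\<^sup>2 dvd
      det (binomial_mat ?D (ext_col ?L h) (ext_exp m l h) (\<lambda>r. ext_node m l r - node m b))"
  proof (rule power_dvd_det_binomial_mat[where \<rho> = "?r a" and \<sigma> = "?r b" and N = ?L, OF _ le])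
    show "inj_on (ext_col ?L h) {..<?D}"
      using bij_betw_ext_col[OF h] by (rule bij_betw_imp_inj_on)
    show "inj_on (?r a) {1..block_size m l a}"
      using r_inj ab(1) by (intro inj_onI) blast
    show "?r a k < ?D \<and> ext_exp m l h (?r a k) = ?L + k \<and> ext_node m l (?r a k) - node m b = node m a - node m b"
      if "k \<in> {1..block_size m l a}" for k
      using ext_block(1-3)[OF ab(1) that] by simp
    show "?r b k < ?D \<and> ext_exp m l h (?r b k) = ?L + k \<and> ext_node m l (?r b k) - node m b = 0"
      if "k \<in> {1..block_size m l b}" for k
      using ext_block(1-3)[OF ab(2) that] by simp
    show "?r a k \<noteq> ?r b k'" if "k \<in> {1..block_size m l a}" "k' \<in> {1..block_size m l b}" for k k'
      using r_inj[of a k b k'] that ab by blast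
  qed
  also have "\<dots> dvd det (ext_mat m l h)"
    unfolding ext_mat_def
    by (rule det_binomial_mat_translate_dvd[OF bij_betw_ext_col[OF h] ext_exp_less[OF h]])
  finally show ?thesis .
qed

text \<open>Replacing \<open>alpha a\<close> by node \<open>b\<close> permits no collision of nodes
  other than that of \<open>a\<close> and \<open>b\<close>, and divisibility by the difference means
  vanishing under this substitution.\<close>

lemma prime_elem_node_diff:
  assumes "a \<in> {1..m}" "a < b" "b \<le> Suc m"
  shows "prime_elem (node m a - node m b)"
    and "c < d \<Longrightarrow> d \<le> Suc m \<Longrightarrow> node m a - node m b dvd node m c - node m d \<longleftrightarrow> c = a \<and> d = b"
proof -
  let ?\<phi> = "msubst (alpha(a := node m b))"
  interpret comm_ring_hom ?\<phi> by (rule msubst_hom)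
  have a: "node m a = alpha a" using assms by (simp add: node_def)
  have \<phi>: "?\<phi> (node m j) = node m (if j = a then b else j)" for j
    using assms by (simp add: node_def)
  then have \<phi>b: "?\<phi> (node m b) = node m b" using assms by simp
  have inj: "node m j = node m j' \<longleftrightarrow> j = j'" if "j \<le> Suc m" "j' \<le> Suc m" for j j'
    using that by (auto simp: node_def)
  have "alpha a \<noteq> node m b" using inj[of a b] assms a by simp
  then show "prime_elem (node m a - node m b)"
    unfolding a by (rule prime_elem_alpha_diff(2)[OF \<phi>b])
  assume cd: "c < d" "d \<le> Suc m"
  have "node m a - node m b dvd node m c - node m d \<longleftrightarrow> ?\<phi> (node m c - node m d) = 0"
    unfolding a by (rule prime_elem_alpha_diff(1)[OF \<phi>b])
  also have "\<dots> \<longleftrightarrow> node m (if c = a then b else c) = node m (if d = a then b else d)"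
    by (simp add: hom_minus \<phi>)
  also have "\<dots> \<longleftrightarrow> c = a \<and> d = b"
    using assms cd by (subst inj) auto
  finally show "node m a - node m b dvd node m c - node m d \<longleftrightarrow> c = a \<and> d = b" .
qed

lemma T_factor_nonzero: "T_factor m l \<noteq> 0"
  by (auto simp: T_factor_def)

text \<open>The factor \<open>\<alpha>\<^sub>j ^ (l\<^sub>j)\<^sup>2\<close> of the determinant of the extended matrix is the product of
  \<open>\<alpha>\<^sub>j ^ (l\<^sub>j choose 2)\<close> and of the factor by which the two determinants differ.\<close>
lemma T_factor_dvd_V_minor:
  assumes h: "h \<le> l_sum m l"
  shows "T_factor m l dvd V_minor m l h"
proof -
  define I where "I = (SIGMA b:{1..Suc m}. {1..<b})"
  define f where "f = (\<lambda>(b, a). node m a - node m b)"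
  define k where "k = (\<lambda>(b, a). min ((block_size m l a)\<^sup>2) ((block_size m l b)\<^sup>2))"
  define W :: "int mpoly" where "W = (\<Prod>j=1..m. alpha j ^ (Suc (l j) choose 2))"
  have "(\<Prod>i\<in>I. f i ^ k i) dvd det (ext_mat m l h)"
  proof (rule prod_prime_elem_power_dvd)
    show "finite I" by (simp add: I_def)
    fix i assume "i \<in> I"
    then obtain a b where i: "i = (b, a)" and ab: "a \<in> {1..m}" "a < b" "b \<le> Suc m"
      by (auto simp: I_def)
    show "prime_elem (f i)"
      using prime_elem_node_diff(1)[OF ab] by (simp add: f_def i)
    show "\<not> f i dvd f i'" if "i' \<in> I" "i \<noteq> i'" for i'
      using that prime_elem_node_diff(2)[OF ab] by (auto simp: f_def i I_def)
    show "f i ^ k i dvd det (ext_mat m l h)"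
    proof (cases "block_size m l a \<le> block_size m l b")
      case True
      then have "k i = (block_size m l a)\<^sup>2" by (simp add: k_def i min_def)
      then show ?thesis
        using node_diff_power_dvd_det_ext_mat[OF h _ _ _ True] ab by (simp add: f_def i)
    next
      case False
      then have "k i = (block_size m l b)\<^sup>2" by (simp add: k_def i min_def)
      moreover have "(node m b - node m a) ^ (block_size m l b)\<^sup>2 dvd det (ext_mat m l h)"
        using node_diff_power_dvd_det_ext_mat[OF h, of b a] False ab by simp
      \<comment> \<open>Here \<open>b\<close> is the smaller block, which yields the difference with
        the opposite sign.\<close>
      moreover have "(- x) ^ n dvd y" if "x ^ n dvd y" for x y :: "int mpoly" and n
        using that by (cases "even n") (simp_all add: power_minus_odd)
      from this[of "node m b - node m a"] have "f i ^ n dvd y"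
        if "(node m b - node m a) ^ n dvd y" for n y
        using that by (simp add: f_def i)
      ultimately show ?thesis by simp
    qed
  qed
  also have "(\<Prod>i\<in>I. f i ^ k i) = (\<Prod>b=1..Suc m. \<Prod>a=1..<b. f (b, a) ^ k (b, a))"
    unfolding I_def by (subst prod.Sigma) (auto intro!: prod.cong)
  also have "\<dots> = (\<Prod>b=1..m. \<Prod>a=1..<b. (alpha a - alpha b) ^ min ((l a)\<^sup>2) ((l b)\<^sup>2)) *
      (\<Prod>a=1..m. alpha a ^ (l a)\<^sup>2)"
  proof -
    have "(\<Prod>b=1..m. \<Prod>a=1..<b. f (b, a) ^ k (b, a))
        = (\<Prod>b=1..m. \<Prod>a=1..<b. (alpha a - alpha b) ^ min ((l a)\<^sup>2) ((l b)\<^sup>2))"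
      by (intro prod.cong) (auto simp: f_def k_def node_def block_size_def)
    moreover have "(\<Prod>a=1..<Suc m. f (Suc m, a) ^ k (Suc m, a)) = (\<Prod>a=1..m. alpha a ^ (l a)\<^sup>2)"
    proof (rule prod.cong)
      fix a assume a: "a \<in> {1..m}"
      then have "(l a)\<^sup>2 \<le> (l_sum m l)\<^sup>2" using le_l_sum by (simp add: power_mono)
      with a show "f (Suc m, a) ^ k (Suc m, a) = alpha a ^ (l a)\<^sup>2"
        by (simp add: f_def k_def node_def block_size_def min_def)
    qed auto
    ultimately show ?thesis by (simp del: prod.op_ivl_Suc)
  qed
  also have "\<dots> = W * T_factor m l"
  proof -
    \<comment> \<open>This splits the exponent \<open>(l j)\<^sup>2\<close> into the share of
      \<open>T_factor\<close> and the share of \<open>W\<close>.\<close>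
    have "(n choose 2) + (Suc n choose 2) = n\<^sup>2" for n
      by (induction n) (auto simp: numeral_2_eq_2 power2_eq_square)
    then have "(alpha j ^ (l j)\<^sup>2 :: int mpoly) = alpha j ^ (l j choose 2) * alpha j ^ (Suc (l j) choose 2)" for j
      by (simp only: power_add[symmetric])
    then show ?thesis by (simp add: T_factor_def W_def prod.distrib ac_simps)
  qed
  also have "det (ext_mat m l h) = W * V_minor m l h"
    unfolding W_def by (rule det_ext_mat[OF h])
  finally have "W = 0 \<or> T_factor m l dvd V_minor m l h"
    by (rule iffD1[OF dvd_mult_cancel_left])
  moreover have "W \<noteq> 0" by (simp add: W_def)
  ultimately show ?thesis by blast
qed

section \<open>Non-vanishing of a minor\<close>

lemma down_closed_eq_lessThan_card:
  fixes S :: "nat set"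
  assumes "finite S" "\<And>r r'. r \<in> S \<Longrightarrow> r' \<le> r \<Longrightarrow> r' \<in> S"
  shows "S = {..<card S}"
proof (rule card_subset_eq)
  show "S \<subseteq> {..<card S}"
  proof
    fix r assume "r \<in> S"
    with assms have "card {..r} \<le> card S" by (intro card_mono) auto
    then show "r \<in> {..<card S}" by simp
  qed
qed auto

text \<open>If the monomials agree, then for each \<open>v\<close> the columns \<open>\<pi> r\<close> of the rows with \<open>j r \<le> v\<close> have the
  least possible sum, so they are the first ones.\<close>
lemma monomial_eq_iff_block_preserving:
  fixes L :: nat and j :: "nat \<Rightarrow> nat"
  assumes mono: "\<And>r r'. r \<le> r' \<Longrightarrow> r' < L \<Longrightarrow> j r \<le> j r'"
    and \<pi>: "\<pi> permutes {..<L}"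
  shows "(\<Sum>r<L. Poly_Mapping.single (j r) (L - \<pi> r)) = (\<Sum>r<L. Poly_Mapping.single (j r) (L - r))
    \<longleftrightarrow> (\<forall>r<L. j (\<pi> r) = j r)"
proof
  assume eq: "(\<Sum>r<L. Poly_Mapping.single (j r) (L - \<pi> r)) = (\<Sum>r<L. Poly_Mapping.single (j r) (L - r))"
  have \<pi>_lt: "\<pi> r < L" if "r < L" for r
    using that permutes_in_image[OF \<pi>, of r] by simp
  define S where "S v = {r. r < L \<and> j r \<le> v}" for v
  have fin: "finite (S v)" for v by (rule finite_subset[of _ "{..<L}"]) (auto simp: S_def)
  have inj: "inj_on \<pi> A" for A
    using permutes_inj[OF \<pi>] by (rule inj_on_subset) simp
  have S_eq: "S v = {..<card (S v)}" for v
    using mono by (intro down_closed_eq_lessThan_card[OF fin]) (force simp: S_def)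
  \<comment> \<open>The left side is the total degree of the monomial in the variables up to
    \<open>v\<close>.\<close>
  have degree: "(\<Sum>w\<le>v. Poly_Mapping.lookup (\<Sum>r<L. Poly_Mapping.single (j r) (f r)) w) = sum f (S v)" for f v
  proof -
    have "(\<Sum>w\<le>v. Poly_Mapping.lookup (\<Sum>r<L. Poly_Mapping.single (j r) (f r)) w)
        = (\<Sum>r<L. \<Sum>w\<le>v. if j r = w then f r else 0)"
      unfolding lookup_sum lookup_single when_def by (rule sum.swap)
    also have "\<dots> = (\<Sum>r<L. if j r \<le> v then f r else 0)"
      by (simp add: sum.delta')
    also have "\<dots> = sum f (S v)"
      by (simp add: S_def sum.If_cases Int_def)
    finally show ?thesis .
  qed
  have image: "\<pi> ` S v = S v" for v
  proof -
    have "(\<Sum>r\<in>S v. L - \<pi> r) = (\<Sum>r\<in>S v. L - r)"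
      using arg_cong[OF eq, of "\<lambda>p. \<Sum>w\<le>v. Poly_Mapping.lookup p w"] unfolding degree .
    moreover have "(\<Sum>r\<in>S v. L - \<pi> r) + (\<Sum>r\<in>S v. \<pi> r) = (\<Sum>r\<in>S v. L)"
      unfolding sum.distrib[symmetric] by (rule sum.cong) (auto simp: S_def \<pi>_lt less_imp_le)
    moreover have "(\<Sum>r\<in>S v. L - r) + (\<Sum>r\<in>S v. r) = (\<Sum>r\<in>S v. L)"
      unfolding sum.distrib[symmetric] by (rule sum.cong) (auto simp: S_def)
    ultimately have "(\<Sum>r\<in>S v. \<pi> r) = \<Sum>(S v)" by linarith
    moreover have "card (\<pi> ` S v) = card (S v)" by (rule card_image[OF inj])
    moreover have "\<Sum>(\<pi> ` S v) = (\<Sum>r\<in>S v. \<pi> r)" by (simp add: sum.reindex[OF inj])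
    moreover have "\<Sum>(S v) = \<Sum>{..<card (S v)}" using S_eq[of v] by (rule arg_cong)
    ultimately have "\<pi> ` S v = {..<card (S v)}"
      using sum_lessThan_card(2)[of "\<pi> ` S v"] fin[of v] by simp
    then show ?thesis using S_eq[of v] by simp
  qed
  show "\<forall>r<L. j (\<pi> r) = j r"
  proof (intro allI impI antisym)
    fix r assume r: "r < L"
    then have "\<pi> r \<in> \<pi> ` S (j r)" by (intro imageI) (simp add: S_def)
    then have "\<pi> r \<in> S (j r)" by (simp only: image)
    then show "j (\<pi> r) \<le> j r" by (simp add: S_def)
    have "\<pi> r \<in> S (j (\<pi> r))" using \<pi>_lt[OF r] by (simp add: S_def)
    then have "\<pi> r \<in> \<pi> ` S (j (\<pi> r))" by (simp only: image)
    then have "r \<in> S (j (\<pi> r))" using permutes_inj[OF \<pi>] by (simp only: inj_image_mem_iff)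
    then show "j r \<le> j (\<pi> r)" by (simp add: S_def)
  qed
next
  assume "\<forall>r<L. j (\<pi> r) = j r"
  then have "(\<Sum>r<L. Poly_Mapping.single (j r) (L - \<pi> r))
      = (\<Sum>r<L. Poly_Mapping.single (j (\<pi> r)) (L - \<pi> r))"
    by (intro sum.cong) auto
  also have "\<dots> = (\<Sum>r<L. Poly_Mapping.single (j r) (L - r))"
    using sum.permute[OF \<pi>, of "\<lambda>r. Poly_Mapping.single (j r) (L - r)"] by (simp add: o_def)
  finally show "(\<Sum>r<L. Poly_Mapping.single (j r) (L - \<pi> r)) = (\<Sum>r<L. Poly_Mapping.single (j r) (L - r))" .
qed

text \<open>The Leibniz terms contributing to this monomial are those whose permutation preserves
  the blocks, and every other term of the block diagonal determinant is 0.\<close>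

lemma lookup_det_block_diagonal:
  fixes j :: "nat \<Rightarrow> nat"
  assumes mono: "\<And>r r'. r \<le> r' \<Longrightarrow> r' < L \<Longrightarrow> j r \<le> j r'"
  shows "Poly_Mapping.lookup (det (mat L L (\<lambda>(r, s). of_int (b r s) * alpha (j r) ^ (L - s)) :: int mpoly mat))
      (\<Sum>r<L. Poly_Mapping.single (j r) (L - r))
    = det (mat L L (\<lambda>(r, s). if j r = j s then b r s else 0))"
    (is "Poly_Mapping.lookup (det ?A) ?e = det ?B")
proof -
  have "Poly_Mapping.lookup (signof \<pi> * (\<Prod>r=0..<L. ?A $$ (r, \<pi> r))) ?e
      = signof \<pi> * (\<Prod>r=0..<L. ?B $$ (r, \<pi> r))" if \<pi>: "\<pi> permutes {0..<L}" for \<pi>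
  proof -
    have \<pi>_lt: "\<pi> r < L" if "r < L" for r
      using that permutes_in_image[OF \<pi>, of r] by simp
    have "(\<Prod>r=0..<L. ?A $$ (r, \<pi> r))
        = (\<Prod>r=0..<L. Poly_Mapping.single (Poly_Mapping.single (j r) (L - \<pi> r)) (b r (\<pi> r)))"
    proof (rule prod.cong)
      fix r assume "r \<in> {0..<L}"
      then have "?A $$ (r, \<pi> r) = mconst (b r (\<pi> r)) * alpha (j r) ^ (L - \<pi> r)"
        by (simp add: \<pi>_lt mconst_int)
      then show "?A $$ (r, \<pi> r) = Poly_Mapping.single (Poly_Mapping.single (j r) (L - \<pi> r)) (b r (\<pi> r))"
        by (simp add: mconst_def alpha_power mult_single)
    qed simp
    also have "\<dots> = Poly_Mapping.single (\<Sum>r<L. Poly_Mapping.single (j r) (L - \<pi> r)) (\<Prod>r=0..<L. b r (\<pi> r))"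
      by (simp add: prod_single lessThan_atLeast0)
    finally have "signof \<pi> * (\<Prod>r=0..<L. ?A $$ (r, \<pi> r))
        = mconst (sign \<pi>) * Poly_Mapping.single (\<Sum>r<L. Poly_Mapping.single (j r) (L - \<pi> r))
            (\<Prod>r=0..<L. b r (\<pi> r))"
      by (simp only: mconst_int)
    also have "\<dots> = Poly_Mapping.single (\<Sum>r<L. Poly_Mapping.single (j r) (L - \<pi> r))
        (sign \<pi> * (\<Prod>r=0..<L. b r (\<pi> r)))"
      by (simp add: mconst_def mult_single)
    finally have lookup: "Poly_Mapping.lookup (signof \<pi> * (\<Prod>r=0..<L. ?A $$ (r, \<pi> r))) ?e
        = (if \<forall>r<L. j (\<pi> r) = j r then sign \<pi> * (\<Prod>r=0..<L. b r (\<pi> r)) else 0)"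
      using monomial_eq_iff_block_preserving[of L j \<pi>, OF mono] \<pi>
      by (simp only: lookup_single when_def lessThan_atLeast0)
    have entry: "?B $$ (r, \<pi> r) = (if j (\<pi> r) = j r then b r (\<pi> r) else 0)" if "r < L" for r
      using that \<pi>_lt by auto
    show ?thesis
    proof (cases "\<forall>r<L. j (\<pi> r) = j r")
      case True
      then have "(\<Prod>r=0..<L. ?B $$ (r, \<pi> r)) = (\<Prod>r=0..<L. b r (\<pi> r))"
        by (intro prod.cong) (auto simp: entry)
      with True show ?thesis unfolding lookup by simp
    next
      case False
      then obtain r where "r < L" "j (\<pi> r) \<noteq> j r" by blast
      then have "?B $$ (r, \<pi> r) = 0" by (simp only: entry if_False)
      with \<open>r < L\<close> have "(\<Prod>r=0..<L. ?B $$ (r, \<pi> r)) = 0" by (intro prod_zero) auto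
      then show ?thesis unfolding lookup if_not_P[OF False] by (simp only: mult_zero_right)
    qed
  qed
  then show ?thesis
    by (subst (1 2) det_def'[OF mat_carrier]) (simp only: lookup_sum, intro sum.cong, auto)
qed

text \<open>Since \<open>(x choose (off + k)) * ((off + k) choose off) = (x choose off) * ((x - off)
  choose k)\<close>, rescaling the unknowns moves the columns of a block to
  \<open>0, ..., l - 1\<close> and the points to \<open>x - off\<close>. The rescaling divides,
  hence the passage to rational numbers.\<close>

lemma binomial_block_eq_0:
  fixes v :: "nat \<Rightarrow> int"
  assumes "\<And>x. N < x \<Longrightarrow> x \<le> N + l \<Longrightarrow> (\<Sum>k<l. int (x choose (off + k)) * v k) = 0"
    and "off + l \<le> N" and "k < l"
  shows "v k = 0"
proof -
  define u where "u k = of_int (v k) / (of_nat ((off + k) choose off) :: rat)" for k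
  have "u k = 0"
  proof (rule binomial_combination_eq_0[OF _ \<open>k < l\<close>, where N = "N + 1 - off"])
    fix x assume x: "N + 1 - off \<le> x" "x < N + 1 - off + l"
    have summand: "of_nat ((x + off) choose off) * (of_nat (x choose k) * u k)
        = of_int (int ((x + off) choose (off + k)) * v k)" if "k < l" for k
    proof -
      have "((x + off) choose (off + k)) * ((off + k) choose off) = ((x + off) choose off) * (x choose k)"
        using choose_mult[of off "off + k" "x + off"] that x assms(2) by simp
      then have "of_nat ((x + off) choose off) * of_nat (x choose k)
          = (of_nat ((x + off) choose (off + k)) * of_nat ((off + k) choose off) :: rat)"
        by (metis of_nat_mult)
      then have "of_nat ((x + off) choose off) * (of_nat (x choose k) * u k)
          = of_nat ((x + off) choose (off + k)) * (of_nat ((off + k) choose off) * u k)"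
        by (simp only: mult.assoc[symmetric])
      also have "of_nat ((off + k) choose off) * u k = of_int (v k)"
        by (simp add: u_def)
      finally show ?thesis by simp
    qed
    have "of_nat ((x + off) choose off) * (\<Sum>k<l. of_nat (x choose k) * u k)
        = of_int (\<Sum>k<l. int ((x + off) choose (off + k)) * v k)"
      unfolding sum_distrib_left of_int_sum by (rule sum.cong) (auto simp only: summand lessThan_iff)
    also have "\<dots> = 0"
      using assms(1)[of "x + off"] assms(2) x by simp
    finally show "(\<Sum>k<l. of_nat (x choose k) * u k) = 0" by simp
  qed
  then show ?thesis by (simp add: u_def)
qed

text \<open>Without column \<open>L\<close>, the columns are \<open>0, ..., L - 1\<close> and form
  blocks parallel to those of the rows. A kernel vector of the resulting block diagonal matrix is
  shown to vanish on each block separately.\<close>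

lemma V_minor_last_nonzero: "V_minor m l (l_sum m l) \<noteq> 0"
proof
  define L where "L = l_sum m l"
  define j where "j r = fst (row_index m l ! r)" for r
  define b where "b r s = int ((L + snd (row_index m l ! r)) choose s)" for r s
  assume "V_minor m l (l_sum m l) = 0"
  moreover have "V_minor m l (l_sum m l) = det (mat L L (\<lambda>(r, s). of_int (b r s) * alpha (j r) ^ (L - s)))"
  proof -
    have "V_mat m l $$ (r, skip L s) = of_int (b r s) * alpha (j r) ^ (L - s)" if "r < L" "s < L" for r s
      using V_mat_index[of r m l s "j r" "snd (row_index m l ! r)"] that
      by (simp add: skip_def L_def[symmetric] j_def b_def)
    then have "mat L L (\<lambda>(r, s). V_mat m l $$ (r, skip L s))
        = mat L L (\<lambda>(r, s). of_int (b r s) * alpha (j r) ^ (L - s))"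
      by (intro eq_matI) auto
    then show ?thesis
      using V_minor_eq[of L m l] by (simp add: L_def)
  qed
  moreover have "j r \<le> j r'" if "r \<le> r'" "r' < L" for r r'
  proof -
    have rr': "r < l_sum m l" "r' < l_sum m l" using that by (simp_all add: L_def)
    obtain a k where a: "a \<in> {1..m}" "k < l a" "r = l_sum (a - 1) l + k"
      using rr'(1) by (rule row_index_cases)
    obtain a' k' where a': "a' \<in> {1..m}" "k' < l a'" "r' = l_sum (a' - 1) l + k'"
      using rr'(2) by (rule row_index_cases)
    have "a \<le> a'"
    proof (rule ccontr)
      assume "\<not> a \<le> a'"
      then have "l_sum (a' - 1) l + k' < l_sum (a - 1) l"
        using a' by (intro l_sum_add_less) auto
      with a a' that show False by simp
    qed
    then show ?thesis
      using row_index_nth[where l = l, OF a(1,2)] row_index_nth[where l = l, OF a'(1,2)] a(3) a'(3)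
      by (simp add: j_def)
  qed
  ultimately have "det (mat L L (\<lambda>(r, s). if j r = j s then b r s else 0)) = 0"
    using lookup_det_block_diagonal[of L j b] by simp
  then obtain v where v: "v \<in> carrier_vec L" "v \<noteq> 0\<^sub>v L"
      "mat L L (\<lambda>(r, s). if j r = j s then b r s else 0) *\<^sub>v v = 0\<^sub>v L"
    by (subst (asm) det_0_iff_vec_prod_zero[OF mat_carrier]) blast
  have row: "(\<Sum>s<L. (if j r = j s then b r s else 0) * v $ s) = 0" if "r < L" for r
  proof -
    have "(mat L L (\<lambda>(r, s). if j r = j s then b r s else 0) *\<^sub>v v) $ r = 0"
      using v(3) that by simp
    with v(1) that show ?thesis by (simp add: scalar_prod_def lessThan_atLeast0)
  qed
  have "v $ s = 0" if "s < L" for s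
  proof -
    obtain a k where a: "a \<in> {1..m}" "k < l a" "s = l_sum (a - 1) l + k"
      using \<open>s < L\<close> unfolding L_def by (rule row_index_cases)
    define off where "off = l_sum (a - 1) l"
    have off: "off + i < L" "j (off + i) = a" "snd (row_index m l ! (off + i)) = Suc i" if "i < l a" for i
      using row_index_nth[where l = l, OF a(1) that] l_sum_add_less[where l = l, OF a(1) that]
      by (simp_all add: off_def L_def j_def)
    have block: "{s. s < L \<and> j s = a} = (+) off ` {..<l a}"
    proof (intro equalityI subsetI)
      fix s assume s: "s \<in> {s. s < L \<and> j s = a}"
      then have "s < l_sum m l" by (simp add: L_def)
      then obtain a' k' where a': "a' \<in> {1..m}" "k' < l a'" "s = l_sum (a' - 1) l + k'"
        by (rule row_index_cases)
      with s have "a' = a" using row_index_nth[where l = l, OF a'(1,2)] by (simp add: j_def)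
      with a' show "s \<in> (+) off ` {..<l a}" by (simp add: off_def)
    qed (use off in auto)
    have "v $ (off + k) = 0"
    proof (rule binomial_block_eq_0[OF _ _ a(2), where N = L])
      show "off + l a \<le> L"
        using off(1)[of "l a - 1"] a(2) by simp
      fix x assume x: "L < x" "x \<le> L + l a"
      \<comment> \<open>The row at position \<open>off + i\<close> has exponent
        \<open>L + Suc i = x\<close>, so it supplies the relation at \<open>x\<close>.\<close>
      define i where "i = x - L - 1"
      have i: "i < l a" "x = L + Suc i" using x by (auto simp: i_def)
      have "0 = (\<Sum>s<L. (if j (off + i) = j s then b (off + i) s else 0) * v $ s)"
        using row[OF off(1)[OF i(1)]] by simp
      also have "\<dots> = (\<Sum>s | s < L \<and> j s = a. int (x choose s) * v $ s)"
        unfolding off(2)[OF i(1)] b_def off(3)[OF i(1)] i(2)[symmetric]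
        by (rule sum.mono_neutral_cong_right) auto
      also have "\<dots> = (\<Sum>k<l a. int (x choose (off + k)) * v $ (off + k))"
        unfolding block by (simp add: sum.reindex)
      finally show "(\<Sum>k<l a. int (x choose (off + k)) * v $ (off + k)) = 0" by simp
    qed
    then show ?thesis using a(3) by (simp add: off_def)
  qed
  then have "v = 0\<^sub>v L" using v(1) by (intro eq_vecI) auto
  with v(2) show False by contradiction
qed

lemma sum_V_minor_V_mat:
  assumes "r < l_sum m l"
  shows "(\<Sum>h\<le>l_sum m l. (- 1) ^ h * V_minor m l h * V_mat m l $$ (r, h)) = 0"
proof -
  let ?L = "l_sum m l"
  \<comment> \<open>Row \<open>r\<close> is repeated on top of the matrix. The determinant vanishes,
    and its expansion along the top row has the signed minors as cofactors.\<close>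
  define M where "M = mat (Suc ?L) (Suc ?L) (\<lambda>(a, h). V_mat m l $$ (if a = 0 then r else a - 1, h))"
  have M: "M \<in> carrier_mat (Suc ?L) (Suc ?L)" by (simp add: M_def)
  have "row M 0 = row M (Suc r)"
    using assms by (intro eq_vecI) (auto simp: M_def)
  then have "det M = 0"
    using assms by (intro det_identical_rows[OF M, of 0 "Suc r"]) auto
  moreover have "cofactor M 0 h = (- 1) ^ h * V_minor m l h" if "h < Suc ?L" for h
  proof -
    have "mat_delete M 0 h = mat ?L ?L (\<lambda>(r, s). V_mat m l $$ (r, skip h s))"
      using that by (intro eq_matI) (auto simp: mat_delete_def M_def skip_def)
    with that show ?thesis by (simp add: cofactor_def V_minor_eq)
  qed
  moreover have "det M = (\<Sum>h<Suc ?L. M $$ (0, h) * cofactor M 0 h)"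
    by (rule laplace_expansion_row[OF M]) simp
  ultimately have "(\<Sum>h<Suc ?L. M $$ (0, h) * ((- 1) ^ h * V_minor m l h)) = 0"
    by simp
  moreover have "(\<Sum>h<Suc ?L. M $$ (0, h) * ((- 1) ^ h * V_minor m l h))
      = (\<Sum>h\<le>?L. (- 1) ^ h * V_minor m l h * V_mat m l $$ (r, h))"
    unfolding lessThan_Suc_atMost by (rule sum.cong) (auto simp: M_def)
  ultimately show ?thesis by simp
qed

section \<open>The approximations\<close>

lemma T_factor_mpolys: "T_factor m l \<in> mpolys m"
  unfolding T_factor_def
  by (intro mpolys_mult mpolys_prod mpolys_power mpolys_diff mpolys_alpha) auto

lemma V_minor_mpolys:
  assumes h: "h \<le> l_sum m l"
  shows "V_minor m l h \<in> mpolys m"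
proof -
  let ?L = "l_sum m l"
  have of_int: "(of_int c :: int mpoly) \<in> mpolys m" for c
    by (simp flip: mconst_int)
  have V: "V_mat m l $$ (r, s) \<in> mpolys m" if rs: "r < ?L" "s \<le> ?L" for r s
  proof -
    obtain j k where jk: "j \<in> {1..m}" "k < l j" "r = l_sum (j - 1) l + k"
      using rs(1) by (rule row_index_cases)
    have "V_mat m l $$ (r, s) = of_int (int ((?L + Suc k) choose s)) * alpha j ^ (?L - s)"
      using V_mat_index[OF rs] row_index_nth[where l = l, OF jk(1,2)] jk(3) by simp
    then show ?thesis
      by (simp only:) (intro mpolys_mult mpolys_power mpolys_alpha of_int jk)
  qed
  show ?thesis
    unfolding V_minor_eq[OF h] det_def'[OF mat_carrier]
  proof (intro mpolys_sum mpolys_mult mpolys_prod of_int)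
    fix \<pi> i assume "\<pi> \<in> {\<pi>. \<pi> permutes {0..<?L}}" "i \<in> {0..<?L}"
    then have "i < ?L" "\<pi> i < ?L" using permutes_in_image[of \<pi> "{0..<?L}" i] by auto
    then show "mat ?L ?L (\<lambda>(r, s). V_mat m l $$ (r, skip h s)) $$ (i, \<pi> i) \<in> mpolys m"
      by (auto simp: skip_def intro!: V)
  qed
qed

lemma msubst_alpha_id: "msubst alpha p = p"
proof (induction p rule: poly_mapping_single_induct)
  case (add e c q)
  have "msubst alpha (Poly_Mapping.single e c) = Poly_Mapping.single e c"
    unfolding msubst_single by (simp only: single_eq_monom_eval[of e c] mconst_int)
  with add show ?case by (simp only: msubst_add)
qed simp

lemma msubst_mpolys_cong:
  assumes "p \<in> mpolys m" "\<And>v. v \<in> {1..m} \<Longrightarrow> g v = g' v"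
  shows "msubst g p = msubst g' p"
proof -
  have "monom_eval g e = monom_eval g' e" if "e \<in> Poly_Mapping.keys p" for e
  proof -
    have "g v = g' v" if "v \<in> Poly_Mapping.keys e" for v
      using assms \<open>e \<in> _\<close> that unfolding mpolys_iff by blast
    then show ?thesis unfolding monom_eval_def by (intro prod.cong) auto
  qed
  then show ?thesis unfolding msubst_def by (intro sum.cong) auto
qed

text \<open>The idea is to set the other variables to \<open>0\<close> in an arbitrary cofactor.\<close>
lemma mpolys_dvdE:
  fixes p q :: "int mpoly"
  assumes "p dvd q" "p \<in> mpolys m" "q \<in> mpolys m"
  obtains u where "u \<in> mpolys m" "q = p * u"
proof -
  let ?g = "\<lambda>v. if v \<in> {1..m} then alpha v else 0 :: int mpoly"
  have id: "msubst ?g p = p" if "p \<in> mpolys m" for p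
    using msubst_mpolys_cong[OF that, of ?g alpha] msubst_alpha_id[of p] by simp
  obtain u where u: "q = p * u" using assms(1) by (rule dvdE)
  have "q = msubst ?g q" by (rule id[OF assms(3), symmetric])
  also have "\<dots> = msubst ?g p * msubst ?g u" unfolding u by (rule msubst_mult)
  also have "\<dots> = p * msubst ?g u" by (simp only: id[OF assms(2)])
  finally have "q = p * msubst ?g u" .
  moreover have "msubst ?g u \<in> mpolys m"
    by (rule mpolys_msubst) (auto intro: mpolys_alpha)
  ultimately show thesis using that by blast
qed

section \<open>Coefficients of the product with the exponential series\<close>

lemma coeff_sum_monom:
  "poly.coeff (\<Sum>i=0..n. Polynomial.monom (c i) i) k = (if k \<le> n then c k else 0)"
  by (simp add: coeff_sum sum.delta)

lemma mconst_mult: "mconst (a * b) = mconst a * (mconst b :: 'a::comm_semiring_1 mpoly)"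
  by (simp add: mconst_def mult_single)

lemma mconst_of_nat: "mconst (of_nat n) = (of_nat n :: 'a::comm_semiring_1 mpoly)"
  by (simp add: mconst_def)

lemma mconst_nonzero: "c \<noteq> 0 \<Longrightarrow> mconst c \<noteq> 0"
  unfolding mconst_def by (metis lookup_single_eq lookup_zero)

text \<open>From \<open>L! / (h! (N - h)!) = (L! / N!) * (N choose h)\<close>. For
  \<open>N = L + i\<close> and \<open>x = alpha j\<close> the remaining sum pairs the
  \<open>\<tau> h\<close> with row \<open>(j, i)\<close> of the matrix.\<close>

lemma exp_t_mult_nth:
  fixes \<tau> :: "nat \<Rightarrow> rat mpoly"
  assumes "L \<le> N"
  shows "fps_nth (fps_of_poly (\<Sum>i=0..L. Polynomial.monom (mconst (fact L / fact i) * \<tau> i) i) * exp_t x) N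
    = mconst (fact L / fact N) * x ^ (N - L) * (\<Sum>h\<le>L. of_nat (N choose h) * (\<tau> h * x ^ (L - h)))"
proof -
  have "fps_nth (fps_of_poly (\<Sum>i=0..L. Polynomial.monom (mconst (fact L / fact i) * \<tau> i) i) * exp_t x) N
      = (\<Sum>i=0..N. (if i \<le> L then mconst (fact L / fact i) * \<tau> i else 0) * (mconst (1 / fact (N - i)) * x ^ (N - i)))"
    by (simp add: fps_mult_nth coeff_sum_monom exp_t_def)
  also have "\<dots> = (\<Sum>h\<le>L. mconst (fact L / fact h) * \<tau> h * (mconst (1 / fact (N - h)) * x ^ (N - h)))"
    using assms by (intro sum.mono_neutral_cong_right) auto
  also have "\<dots> = (\<Sum>h\<le>L. mconst (fact L / fact N) * x ^ (N - L) * (of_nat (N choose h) * (\<tau> h * x ^ (L - h))))"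
  proof (rule sum.cong)
    fix h assume "h \<in> {..L}"
    then have h: "h \<le> L" "h \<le> N" using assms by auto
    have "fact L / fact h * (1 / fact (N - h)) = (fact L / fact N * of_nat (N choose h) :: rat)"
      using h by (simp add: binomial_fact)
    then have "mconst (fact L / fact h) * mconst (1 / fact (N - h))
        = mconst (fact L / fact N) * (of_nat (N choose h) :: rat mpoly)"
      by (simp only: mconst_mult[symmetric] mconst_of_nat[symmetric])
    moreover have "x ^ (N - h) = x ^ (N - L) * x ^ (L - h)"
      using h assms by (simp flip: power_add)
    ultimately show "mconst (fact L / fact h) * \<tau> h * (mconst (1 / fact (N - h)) * x ^ (N - h))
        = mconst (fact L / fact N) * x ^ (N - L) * (of_nat (N choose h) * (\<tau> h * x ^ (L - h)))"
      by (metis (no_types, lifting) mult.assoc mult.left_commute)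
  qed simp
  finally show ?thesis by (simp only: sum_distrib_left)
qed

theorem theorem2p2:
  fixes m :: nat and l :: "nat \<Rightarrow> nat"
  assumes "m \<ge> 1" and "\<And>j. j \<in> {1..m} \<Longrightarrow> l j > 0"
  defines "L \<equiv> l_sum m l"
  shows "T_factor m l \<noteq> 0 \<and> (\<forall>i\<le>L. T_factor m l dvd V_minor m l i) \<and>
    (\<exists>(B :: nat \<Rightarrow> rat mpoly poly) (S :: nat \<Rightarrow> rat mpoly fps) (\<tau> :: nat \<Rightarrow> int mpoly).
      (\<forall>j\<le>m. B j \<noteq> 0 \<and> (\<forall>n. poly.coeff (B j) n \<in> mpolys m)) \<and>
      (\<forall>j\<in>{1..m}. \<forall>n. fps_nth (S j) n \<in> mpolys m) \<and>
      (\<forall>j\<in>{1..m}. fps_of_poly (B 0) * exp_t (alpha j) - fps_of_poly (B j) = S j) \<and>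
      (\<forall>j\<le>m. Polynomial.degree (B j) \<le> L) \<and>
      (\<forall>j\<in>{1..m}. enat (L + l j + 1) \<le> ord_t (S j) \<and> ord_t (S j) < \<infinity>) \<and>
      (\<forall>i\<le>L. \<tau> i \<in> mpolys m \<and> T_factor m l * \<tau> i = (- 1) ^ i * V_minor m l i) \<and>
      B 0 = (\<Sum>i = 0..L. Polynomial.monom (mconst (fact L / fact i) * rat_mpoly (\<tau> i)) i))"
proof (intro conjI T_factor_nonzero)
  interpret rat: inj_comm_ring_hom rat_mpoly by (rule rat_mpoly_hom)
  let ?T = "T_factor m l"
  show dvd: "\<forall>i\<le>L. ?T dvd V_minor m l i"
    unfolding L_def using T_factor_dvd_V_minor by blast
  have "\<exists>u. u \<in> mpolys m \<and> ?T * u = (- 1) ^ i * V_minor m l i" if "i \<le> L" for i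
  proof -
    obtain u where u: "u \<in> mpolys m" "V_minor m l i = ?T * u"
      using mpolys_dvdE[OF _ T_factor_mpolys V_minor_mpolys] dvd \<open>i \<le> L\<close> unfolding L_def by metis
    have "(- 1) ^ i * u \<in> mpolys m"
      by (intro mpolys_mult mpolys_power mpolys_uminus mpolys_1 u)
    then show ?thesis using u(2) by (metis mult.left_commute)
  qed
  then obtain \<tau> where \<tau>: "\<tau> i \<in> mpolys m" "?T * \<tau> i = (- 1) ^ i * V_minor m l i" if "i \<le> L" for i
    by metis
  have \<tau>L: "\<tau> L \<noteq> 0"
  proof
    assume "\<tau> L = 0"
    with \<tau>(2)[of L] have "(- 1) ^ L * V_minor m l L = 0" by simp
    then show False using V_minor_last_nonzero[of m l] by (simp add: L_def)
  qed
  define c where "c i = mconst (fact L / fact i) * rat_mpoly (\<tau> i)" for i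
  define B0 where "B0 = (\<Sum>i=0..L. Polynomial.monom (c i) i)"
  define F where "F j = fps_of_poly B0 * exp_t (alpha j)" for j
  \<comment> \<open>For \<open>j > 0\<close> this truncates \<open>F j\<close> after
    \<open>t ^ L\<close>, so the remainder starts beyond \<open>L\<close> by construction.\<close>
  define B where "B j = (if j = 0 then B0 else \<Sum>i=0..L. Polynomial.monom (fps_nth (F j) i) i)" for j
  define S where "S j = F j - fps_of_poly (B j)" for j
  have c_mpolys: "c i \<in> mpolys m" if "i \<le> L" for i
    unfolding c_def by (intro mpolys_mult mpolys_mconst mpolys_rat_mpoly \<tau> that)
  have coeff_B0: "poly.coeff B0 n = (if n \<le> L then c n else 0)" for n
    by (simp add: B0_def coeff_sum_monom)
  have coeff_B: "poly.coeff (B j) n = (if n \<le> L then fps_nth (F j) n else 0)" if "j \<in> {1..m}" for j n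
    using that by (simp add: B_def coeff_sum_monom)
  have S_nth: "fps_nth (S j) n = (if n \<le> L then 0 else fps_nth (F j) n)" if "j \<in> {1..m}" for j n
    by (simp add: S_def coeff_B[OF that])
  have F_nth: "fps_nth (F j) N = mconst (fact L / fact N) * alpha j ^ (N - L) *
      (\<Sum>h\<le>L. of_nat (N choose h) * (rat_mpoly (\<tau> h) * alpha j ^ (L - h)))" if "L \<le> N" for j N
    unfolding F_def B0_def c_def by (rule exp_t_mult_nth[OF that])
  have F_mpolys: "fps_nth (F j) n \<in> mpolys m" if "j \<in> {1..m}" for j n
    unfolding F_def fps_mult_nth exp_t_def fps_nth_Abs_fps fps_of_poly_nth coeff_B0
    using that by (intro mpolys_sum mpolys_mult mpolys_mconst mpolys_power mpolys_alpha) (auto intro: c_mpolys)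
  have "c L \<noteq> 0"
    using \<tau>L by (simp add: c_def mconst_nonzero)
  then have B0_nonzero: "B0 \<noteq> 0" using coeff_B0[of L] by auto
  have F_zero: "fps_nth (F j) (L + i) = 0" if j: "j \<in> {1..m}" and i: "0 < i" "i \<le> l j" for i j
  proof -
    define r where "r = l_sum (j - 1) l + (i - 1)"
    have r: "r < L" "row_index m l ! r = (j, i)"
      using row_index_nth[of j m "i - 1" l] l_sum_add_less[of j m "i - 1" l] j i
      by (simp_all add: r_def L_def)
    have V: "V_mat m l $$ (r, h) = of_nat ((L + i) choose h) * alpha j ^ (L - h)" if "h \<le> L" for h
      using V_mat_index[of r m l h j i] r that by (simp add: L_def)
    \<comment> \<open>Multiplying by \<open>T_factor\<close> restores the signed minors, for which
      the relation with row \<open>r\<close> is known; the factor is then cancelled over the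
      integers.\<close>
    have "?T * (\<Sum>h\<le>L. of_nat ((L + i) choose h) * (\<tau> h * alpha j ^ (L - h)))
        = (\<Sum>h\<le>L. (?T * \<tau> h) * V_mat m l $$ (r, h))"
      unfolding sum_distrib_left by (rule sum.cong) (auto simp: V ac_simps)
    also have "\<dots> = (\<Sum>h\<le>L. (- 1) ^ h * V_minor m l h * V_mat m l $$ (r, h))"
      by (rule sum.cong) (auto simp: \<tau>(2))
    also have "\<dots> = 0"
      using sum_V_minor_V_mat[of r m l] r(1) by (simp add: L_def)
    finally have "(\<Sum>h\<le>L. of_nat ((L + i) choose h) * (\<tau> h * alpha j ^ (L - h))) = 0"
      using T_factor_nonzero by simp
    then have "rat_mpoly (\<Sum>h\<le>L. of_nat ((L + i) choose h) * (\<tau> h * alpha j ^ (L - h))) = 0"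
      by simp
    then have "(\<Sum>h\<le>L. of_nat ((L + i) choose h) * (rat_mpoly (\<tau> h) * alpha j ^ (L - h))) = 0"
      by (simp only: rat.hom_sum rat.hom_mult rat.hom_power rat.hom_of_nat rat_mpoly_alpha)
    then show ?thesis by (simp add: F_nth)
  qed
  have S_nonzero: "S j \<noteq> 0" if j: "j \<in> {1..m}" for j
  proof
    assume "S j = 0"
    \<comment> \<open>The \<open>L + 1\<close> vanishing coefficients from order
      \<open>L + 1\<close> on force all \<open>L + 1\<close> terms to be 0. The last term is taken
      because \<open>\<tau> L\<close> is known to be nonzero.\<close>
    have "rat_mpoly (\<tau> L) * alpha j ^ (L - L) = 0"
    proof (rule binomial_combination_eq_0[where N = "L + 1" and l = "Suc L" and k = L
          and u = "\<lambda>h. rat_mpoly (\<tau> h) * alpha j ^ (L - h)"])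
      fix N assume "L + 1 \<le> N"
      then have "fps_nth (F j) N = 0"
        using S_nth[OF j, of N] \<open>S j = 0\<close> by simp
      with \<open>L + 1 \<le> N\<close> show "(\<Sum>h<Suc L. of_nat (N choose h) * (rat_mpoly (\<tau> h) * alpha j ^ (L - h))) = 0"
        by (simp add: F_nth mconst_nonzero lessThan_Suc_atMost del: sum.lessThan_Suc)
    qed simp
    with \<tau>L show False by simp
  qed
  have B_nonzero: "B j \<noteq> 0" if "j \<le> m" for j
  proof (cases "j = 0")
    case True
    with B0_nonzero show ?thesis by (simp add: B_def)
  next
    case False
    with that have j: "j \<in> {1..m}" by simp
    have exp0: "fps_nth (exp_t (alpha j)) 0 = 1"
      by (simp add: exp_t_def mconst_def)
    then have exp: "exp_t (alpha j) \<noteq> 0" "subdegree (exp_t (alpha j)) = 0" by (auto intro: subdegree_eq_0)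
    define n where "n = subdegree (F j)"
    have "F j \<noteq> 0" unfolding F_def using B0_nonzero exp(1) by simp
    then have "fps_nth (F j) n \<noteq> 0" unfolding n_def by (rule nth_subdegree_nonzero)
    \<comment> \<open>The exponential series has constant term 1, so \<open>F j\<close> starts at
      the same order as \<open>B0\<close>, which is at most \<open>L\<close>; the truncation keeps
      this first coefficient.\<close>
    moreover have "n = subdegree (fps_of_poly B0)"
      unfolding n_def F_def using B0_nonzero exp by (simp add: subdegree_mult)
    then have "n \<le> L"
      using subdegree_leI[of "fps_of_poly B0" L] \<open>c L \<noteq> 0\<close> coeff_B0[of L] by simp
    ultimately show ?thesis using coeff_B[OF j, of n] by auto
  qed
  have ord: "enat (L + l j + 1) \<le> ord_t (S j) \<and> ord_t (S j) < \<infinity>" if j: "j \<in> {1..m}" for j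
  proof -
    have "fps_nth (S j) n = 0" if "n < L + l j + 1" for n
      using S_nth[OF j, of n] F_zero[OF j, of "n - L"] that by (cases "n \<le> L") auto
    then have "L + l j + 1 \<le> subdegree (S j)"
      using S_nonzero[OF j] by (intro subdegree_geI)
    then show ?thesis using S_nonzero[OF j] by (simp add: ord_t_def)
  qed
  have coeff_mpolys: "poly.coeff (B j) n \<in> mpolys m" if "j \<le> m" for j n
  proof (cases "j = 0")
    case True
    then show ?thesis using c_mpolys by (simp add: B_def coeff_B0)
  next
    case False
    then show ?thesis using that F_mpolys by (simp add: coeff_B)
  qed
  have degree: "Polynomial.degree (B j) \<le> L" if "j \<le> m" for j
  proof (rule degree_le, intro allI impI)
    fix n assume "L < n"
    then show "poly.coeff (B j) n = 0"
      using coeff_B0[of n] coeff_B[of j n] that by (cases "j = 0") (auto simp: B_def)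
  qed
  show "\<exists>(B :: nat \<Rightarrow> rat mpoly poly) (S :: nat \<Rightarrow> rat mpoly fps) (\<tau> :: nat \<Rightarrow> int mpoly).
      (\<forall>j\<le>m. B j \<noteq> 0 \<and> (\<forall>n. poly.coeff (B j) n \<in> mpolys m)) \<and>
      (\<forall>j\<in>{1..m}. \<forall>n. fps_nth (S j) n \<in> mpolys m) \<and>
      (\<forall>j\<in>{1..m}. fps_of_poly (B 0) * exp_t (alpha j) - fps_of_poly (B j) = S j) \<and>
      (\<forall>j\<le>m. Polynomial.degree (B j) \<le> L) \<and>
      (\<forall>j\<in>{1..m}. enat (L + l j + 1) \<le> ord_t (S j) \<and> ord_t (S j) < \<infinity>) \<and>
      (\<forall>i\<le>L. \<tau> i \<in> mpolys m \<and> ?T * \<tau> i = (- 1) ^ i * V_minor m l i) \<and>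
      B 0 = (\<Sum>i = 0..L. Polynomial.monom (mconst (fact L / fact i) * rat_mpoly (\<tau> i)) i)"
  proof (rule exI[of _ B], rule exI[of _ S], rule exI[of _ \<tau>], intro conjI ballI allI impI)
    show "fps_nth (S j) n \<in> mpolys m" if "j \<in> {1..m}" for j n
      unfolding S_nth[OF that] using F_mpolys[OF that] by simp
    show "fps_of_poly (B 0) * exp_t (alpha j) - fps_of_poly (B j) = S j" for j
      by (simp add: S_def F_def B_def)
    show "B 0 = (\<Sum>i = 0..L. Polynomial.monom (mconst (fact L / fact i) * rat_mpoly (\<tau> i)) i)"
      by (simp add: B_def B0_def c_def)
  qed (use B_nonzero coeff_mpolys degree ord \<tau> in blast)+
qed

end
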